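(* Let $P$ be a $\mathtt{ReDiP}$ program. The transformer $[\![P]\!]$, defined on second-order PGF by the same rules as on PGF, is a well-defined map from SOP to SOP. Further, if $f=\sum_{\tau\in\mathbb{N}^{|\vec U|}} f(\tau)\vec U^\tau$ is an SOP (with $f(\tau)\in\mathbb{R}[[\vec X]]$), then $[\![P]\!](f)=\sum_{\tau\in\mathbb{N}^{|\vec U|}}[\![P]\!](f(\tau))\vec U^\tau$.
   Context: FPS: for indeterminates $\vec Z$, $\mathbb{R}[[\vec Z]]$ is the ring of maps $\mathbb{N}^{|\vec Z|}\to\mathbb{R}$ written as formal sums $\sum_\sigma f(\sigma)\vec Z^\sigma$, with coefficient-wise addition and Cauchy product. A PGF is an FPS in the program indeterminates $\vec X=(X_1,\dots,X_k)$ with nonnegative coefficients summing to at most 1. Second-order PGF (SOP): for a vector $\vec U$ of "meta" indeterminates disjoint from $\vec X$, an FPS $f\in\mathbb{R}[[\vec U,\vec X]]$ is an SOP if, writing $f=\sum_{\tau}f(\tau)\vec U^\tau$ with $f(\tau)\in\mathbb{R}[[\vec X]]$, every $f(\tau)$ is a PGF. SOP are ordered coefficient-wise. $\mathtt{ReDiP}$ syntax (variables $x_1,\dots,x_k$ over $\mathbb{N}$, indeterminate $X$ for variable $x$): $P ::= x := n \mid x{-}{-} \mid x \mathrel{+}= \mathrm{iid}(D, y) \mid \mathtt{if}(x<n)\{P_1\}\mathtt{else}\{P_2\} \mid P_1; P_2 \mid \mathtt{while}(x<n)\{P_1\}$. Transformer rules (all substitutions/derivatives only in non-meta indeterminates $X,Y\in\vec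 X$): $[\![x:=n]\!](g)=g[X/1]X^n$; $[\![x{-}{-}]\!](g)=(g-g[X/0])X^{-1}+g[X/0]$ (left shift in $X$ plus the $X$-free part); $[\![x\mathrel{+}=\mathrm{iid}(D,y)]\!](g)=g[Y/Y[\![D]\!][T/X]]$ with $[\![D]\!]$ the PGF of $D$ in indeterminate $T$; $[\![\mathtt{if}(x<n)\{P_1\}\mathtt{else}\{P_2\}]\!](g)=[\![P_1]\!](g_{x<n})+[\![P_2]\!](g-g_{x<n})$ with $g_{x<n}=\sum_{i=0}^{n-1}\frac1{i!}(\partial_X^ig)[X/0]X^i$; $[\![P_1;P_2]\!]=[\![P_2]\!]\circ[\![P_1]\!]$; $[\![\mathtt{while}(x<n)\{P\}]\!]$ is the least fixed point of $\psi\mapsto\lambda f.(f-f_{x<n})+\psi([\![P]\!](f_{x<n}))$. Here for $f=\sum_if(i)X^i$ (coefficients FPS in the remaining indeterminates), $f[X/h]=\sum_if(i)h^i$, $f[X/0]=f(0)$, $f[X/1]=\sum_if(i)$. *)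

theory Defs
  imports
    "HOL-Library.Poly_Mapping"
    "HOL-Computational_Algebra.Formal_Power_Series"
    "HOL-Probability.SPMF"
begin

section \<open>Multivariate formal power series\<close>

abbreviation lookup :: "('i \<Rightarrow>\<^sub>0 'a::zero) \<Rightarrow> 'i \<Rightarrow> 'a" where
  "lookup \<equiv> Poly_Mapping.lookup"

abbreviation keys :: "('i \<Rightarrow>\<^sub>0 'a::zero) \<Rightarrow> 'i set" where
  "keys \<equiv> Poly_Mapping.keys"

text \<open>
  The elements of type \<open>'i\<close> are indeterminates and a finitely supported \<open>\<sigma> :: 'i \<Rightarrow>\<^sub>0 nat\<close> is the
  exponent of the monomial \<open>\<Prod>i. i ^ lookup \<sigma> i\<close>. The ring of series over a particular set \<open>Z\<close> of
  indeterminates is the subring \<open>mfps_over Z\<close> below.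
\<close>

typedef 'i mfps = "UNIV :: (('i \<Rightarrow>\<^sub>0 nat) \<Rightarrow> real) set"
  morphisms mcoeff Abs_mfps ..

lemma mcoeff_Abs [simp]: "mcoeff (Abs_mfps f) = f"
  by (simp add: Abs_mfps_inverse)

lemma mfps_eqI: "(\<And>\<sigma>. mcoeff f \<sigma> = mcoeff g \<sigma>) \<Longrightarrow> f = g"
  by (simp add: mcoeff_inject [symmetric] fun_eq_iff)

lemma finite_exponent_sums [simp]: "finite {p. fst p + snd p = (\<sigma> :: 'i \<Rightarrow>\<^sub>0 nat)}"
proof -
  let ?B = "{\<alpha>. \<forall>i. lookup \<alpha> i \<le> lookup \<sigma> i}"
  define m where "m = Max (lookup \<sigma> ` keys \<sigma>)"
  have m: "lookup \<sigma> i \<le> m" if "i \<in> keys \<sigma>" for i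
    using that by (auto simp: m_def intro!: Max_ge)
  have "lookup ` ?B \<subseteq> {f. \<forall>i. (i \<in> keys \<sigma> \<longrightarrow> f i \<in> {..m}) \<and> (i \<notin> keys \<sigma> \<longrightarrow> f i = 0)}"
  proof (intro image_subsetI CollectI allI conjI impI)
    fix \<alpha> i
    assume "\<alpha> \<in> ?B"
    then have le: "lookup \<alpha> i \<le> lookup \<sigma> i"
      by blast
    show "lookup \<alpha> i \<in> {..m}" if "i \<in> keys \<sigma>"
      using order.trans [OF le m [OF that]] by blast
    from le show "lookup \<alpha> i = 0" if "i \<notin> keys \<sigma>"
      using that by (simp add: in_keys_iff)
  qed
  moreover have "finite \<dots>"
    by (rule finite_set_of_finite_funs) auto
  ultimately have "finite (lookup ` ?B)"
    by (rule finite_subset)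
  moreover have "inj_on lookup ?B"
    by (intro inj_onI poly_mapping_eqI) simp
  ultimately have "finite ?B"
    by (rule finite_imageD)
  moreover have "{p. fst p + snd p = \<sigma>} \<subseteq> ?B \<times> ?B"
    by (auto simp: lookup_add)
  ultimately show ?thesis
    using finite_subset [OF _ finite_cartesian_product] by blast
qed

instantiation mfps :: (type) comm_ring_1
begin

definition "0 = Abs_mfps (\<lambda>_. 0)"
definition "1 = Abs_mfps (\<lambda>\<sigma>. if \<sigma> = 0 then 1 else 0)"
definition "f + g = Abs_mfps (\<lambda>\<sigma>. mcoeff f \<sigma> + mcoeff g \<sigma>)"
definition "f - g = Abs_mfps (\<lambda>\<sigma>. mcoeff f \<sigma> - mcoeff g \<sigma>)"
definition "- f = Abs_mfps (\<lambda>\<sigma>. - mcoeff f \<sigma>)"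
definition "f * g = Abs_mfps (\<lambda>\<sigma>. \<Sum>(\<alpha>, \<beta>) | \<alpha> + \<beta> = \<sigma>. mcoeff f \<alpha> * mcoeff g \<beta>)"

instance
proof
  fix f g h :: "'a mfps"
  show "f * g * h = f * (g * h)"
  proof (rule mfps_eqI)
    fix \<sigma> :: "'a \<Rightarrow>\<^sub>0 nat"
    have "mcoeff (f * g * h) \<sigma> =
        (\<Sum>(p, q)\<in>(SIGMA p:{p. fst p + snd p = \<sigma>}. {q. fst q + snd q = fst p}).
           mcoeff f (fst q) * mcoeff g (snd q) * mcoeff h (snd p))"
      by (subst sum.Sigma [symmetric])
         (auto simp: times_mfps_def sum_distrib_right case_prod_unfold)
    also have "\<dots> =
        (\<Sum>(p, q)\<in>(SIGMA p:{p. fst p + snd p = \<sigma>}. {q. fst q + snd q = snd p}).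
           mcoeff f (fst p) * (mcoeff g (fst q) * mcoeff h (snd q)))"
      by (rule sum.reindex_bij_witness
            [where i = "\<lambda>((a, b), (c, d)). ((a + c, d), (a, c))"
               and j = "\<lambda>((a, b), (c, d)). ((c, d + b), (d, b))"])
         (auto simp: add.assoc)
    also have "\<dots> = mcoeff (f * (g * h)) \<sigma>"
      by (subst sum.Sigma [symmetric])
         (auto simp: times_mfps_def sum_distrib_left case_prod_unfold)
    finally show "mcoeff (f * g * h) \<sigma> = mcoeff (f * (g * h)) \<sigma>" .
  qed
  show "f * g = g * f"
    unfolding times_mfps_def
    by (intro arg_cong [where f = Abs_mfps] ext sum.reindex_bij_witness
          [where i = "\<lambda>(a, b). (b, a)" and j = "\<lambda>(a, b). (b, a)"])
       (auto simp: add.commute)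
  show "1 * f = f"
  proof (rule mfps_eqI)
    fix \<sigma> :: "'a \<Rightarrow>\<^sub>0 nat"
    have "mcoeff (1 * f) \<sigma> = (\<Sum>p | fst p + snd p = \<sigma>. if p = (0, \<sigma>) then mcoeff f \<sigma> else 0)"
      unfolding times_mfps_def mcoeff_Abs
      by (rule sum.cong) (auto simp: one_mfps_def case_prod_unfold)
    also have "\<dots> = mcoeff f \<sigma>"
      by (simp add: sum.delta)
    finally show "mcoeff (1 * f) \<sigma> = mcoeff f \<sigma>" .
  qed
  show "(f + g) * h = f * h + g * h"
    by (rule mfps_eqI)
       (simp add: times_mfps_def plus_mfps_def sum.distrib case_prod_unfold algebra_simps)
  have "mcoeff (0 :: 'a mfps) 0 \<noteq> mcoeff 1 0"
    by (simp add: zero_mfps_def one_mfps_def)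
  then show "(0 :: 'a mfps) \<noteq> 1"
    by metis
qed (auto intro!: mfps_eqI simp: plus_mfps_def zero_mfps_def minus_mfps_def uminus_mfps_def)

end

instantiation mfps :: (type) order
begin

definition "f \<le> g \<longleftrightarrow> (\<forall>\<sigma>. mcoeff f \<sigma> \<le> mcoeff g \<sigma>)"
definition "(f :: 'a mfps) < g \<longleftrightarrow> f \<le> g \<and> \<not> g \<le> f"

instance
proof
  fix f g h :: "'a mfps"
  show "f < g \<longleftrightarrow> f \<le> g \<and> \<not> g \<le> f"
    by (rule less_mfps_def)
  show "f \<le> f"
    by (simp add: less_eq_mfps_def)
  show "f \<le> h" if "f \<le> g" "g \<le> h"
    using that unfolding less_eq_mfps_def by (meson order.trans)
  show "f = g" if "f \<le> g" "g \<le> f"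
    using that unfolding less_eq_mfps_def by (blast intro: mfps_eqI order.antisym)
qed

end

lemma mcoeff_simps [simp]:
  "mcoeff 0 \<sigma> = 0"
  "mcoeff 1 \<sigma> = (if \<sigma> = 0 then 1 else 0)"
  "mcoeff (f + g) \<sigma> = mcoeff f \<sigma> + mcoeff g \<sigma>"
  "mcoeff (f - g) \<sigma> = mcoeff f \<sigma> - mcoeff g \<sigma>"
  "mcoeff (- f) \<sigma> = - mcoeff f \<sigma>"
  by (simp_all add: zero_mfps_def one_mfps_def plus_mfps_def minus_mfps_def uminus_mfps_def)

lemma mcoeff_sum: "mcoeff (sum F A) \<sigma> = (\<Sum>a\<in>A. mcoeff (F a) \<sigma>)"
  by (induction A rule: infinite_finite_induct) auto

definition monomial :: "('i \<Rightarrow>\<^sub>0 nat) \<Rightarrow> real \<Rightarrow> 'i mfps" where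
  "monomial \<tau> c = Abs_mfps (\<lambda>\<sigma>. if \<sigma> = \<tau> then c else 0)"

abbreviation const :: "real \<Rightarrow> 'i mfps" where
  "const c \<equiv> monomial 0 c"

abbreviation Var :: "'i \<Rightarrow> 'i mfps" where
  "Var x \<equiv> monomial (Poly_Mapping.single x 1) 1"

definition mfps_over :: "'i set \<Rightarrow> 'i mfps set" where
  "mfps_over Z = {f. \<forall>\<sigma>. mcoeff f \<sigma> \<noteq> 0 \<longrightarrow> keys \<sigma> \<subseteq> Z}"

text \<open>Infinite sums of series are taken coefficient-wise, with unconditional convergence in \<open>\<real>\<close>.\<close>

definition formally_summable :: "('a \<Rightarrow> 'i mfps) \<Rightarrow> 'a set \<Rightarrow> bool" where
  "formally_summable F A \<longleftrightarrow> (\<forall>\<sigma>. (\<lambda>a. mcoeff (F a) \<sigma>) summable_on A)"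

definition formal_sum :: "('a \<Rightarrow> 'i mfps) \<Rightarrow> 'a set \<Rightarrow> 'i mfps" where
  "formal_sum F A = Abs_mfps (\<lambda>\<sigma>. \<Sum>\<^sub>\<infinity>a\<in>A. mcoeff (F a) \<sigma>)"


section \<open>Substitution and differentiation\<close>

text \<open>\<open>slice x i f\<close> is the coefficient \<open>f(i)\<close> in \<open>f = (\<Sum>i. f(i) * X^i)\<close>; it is free of \<open>X\<close>.\<close>

definition slice :: "'i \<Rightarrow> nat \<Rightarrow> 'i mfps \<Rightarrow> 'i mfps" where
  "slice x i f =
     Abs_mfps (\<lambda>\<sigma>. if lookup \<sigma> x = 0 then mcoeff f (\<sigma> + Poly_Mapping.single x i) else 0)"

definition substitutable :: "'i mfps \<Rightarrow> 'i \<Rightarrow> 'i mfps \<Rightarrow> bool" where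
  "substitutable f x h \<longleftrightarrow> formally_summable (\<lambda>i. slice x i f * h ^ i) UNIV"

definition subst :: "'i mfps \<Rightarrow> 'i \<Rightarrow> 'i mfps \<Rightarrow> 'i mfps" where
  "subst f x h = formal_sum (\<lambda>i. slice x i f * h ^ i) UNIV"

lemma substitutable_0: "substitutable f x 0"
  unfolding substitutable_def formally_summable_def
proof
  fix \<sigma>
  have "(\<lambda>i. mcoeff (slice x i f * 0 ^ i) \<sigma>) summable_on {0}"
    by simp
  then show "(\<lambda>i. mcoeff (slice x i f * 0 ^ i) \<sigma>) summable_on UNIV"
    by (rule summable_on_cong_neutral [THEN iffD1, rotated -1]) (auto simp: power_0_left)
qed

lemma subst_0: "subst f x 0 = slice x 0 f"
proof (rule mfps_eqI)
  fix \<sigma>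
  have "(\<Sum>\<^sub>\<infinity>i\<in>UNIV. mcoeff (slice x i f * 0 ^ i) \<sigma>) =
      (\<Sum>\<^sub>\<infinity>i\<in>{0}. mcoeff (slice x i f * 0 ^ i) \<sigma>)"
    by (rule infsum_cong_neutral) (auto simp: power_0_left)
  then show "mcoeff (subst f x 0) \<sigma> = mcoeff (slice x 0 f) \<sigma>"
    by (simp add: subst_def formal_sum_def)
qed

definition partial_deriv :: "'i \<Rightarrow> 'i mfps \<Rightarrow> 'i mfps" where
  "partial_deriv x f =
     Abs_mfps (\<lambda>\<sigma>. real (lookup \<sigma> x + 1) * mcoeff f (\<sigma> + Poly_Mapping.single x 1))"

text \<open>Multiplication by \<open>X^(-1)\<close>; used only for series divisible by \<open>X\<close>.\<close>

definition shift_left :: "'i \<Rightarrow> 'i mfps \<Rightarrow> 'i mfps" where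
  "shift_left x f = Abs_mfps (\<lambda>\<sigma>. mcoeff f (\<sigma> + Poly_Mapping.single x 1))"

text \<open>The univariate series \<open>p\<close> in the indeterminate \<open>T\<close>, with \<open>X\<close> substituted for \<open>T\<close>.\<close>

definition fps_at_var :: "real fps \<Rightarrow> 'i \<Rightarrow> 'i mfps" where
  "fps_at_var p x = formal_sum (\<lambda>n. const (fps_nth p n) * Var x ^ n) UNIV"

definition restrict_less :: "'i \<Rightarrow> nat \<Rightarrow> 'i mfps \<Rightarrow> 'i mfps" where
  "restrict_less x n g =
     (\<Sum>i<n. const (1 / fact i) * subst ((partial_deriv x ^^ i) g) x 0 * Var x ^ i)"


section \<open>PGF and second-order PGF\<close>

definition pgf :: "'i set \<Rightarrow> 'i mfps set" where
  "pgf X = {f \<in> mfps_over X.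
     (\<forall>\<sigma>. 0 \<le> mcoeff f \<sigma>) \<and> (\<exists>s\<le>1. (mcoeff f has_sum s) UNIV)}"

text \<open>
  For \<open>f \<in> mfps_over (U \<union> X)\<close> with \<open>X \<inter> U = {}\<close> and \<open>keys \<tau> \<subseteq> U\<close>, \<open>meta_coeff X \<tau> f\<close> is the
  coefficient \<open>f(\<tau>) \<in> mfps_over X\<close> in \<open>f = (\<Sum>\<tau>. f(\<tau>) * U^\<tau>)\<close>; see \<open>meta_expansion\<close>.
\<close>

definition meta_coeff :: "'i set \<Rightarrow> ('i \<Rightarrow>\<^sub>0 nat) \<Rightarrow> 'i mfps \<Rightarrow> 'i mfps" where
  "meta_coeff X \<tau> f = Abs_mfps (\<lambda>\<sigma>. if keys \<sigma> \<subseteq> X then mcoeff f (\<tau> + \<sigma>) else 0)"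

definition sop :: "'i set \<Rightarrow> 'i set \<Rightarrow> 'i mfps set" where
  "sop U X = {f \<in> mfps_over (U \<union> X). \<forall>\<tau>. keys \<tau> \<subseteq> U \<longrightarrow> meta_coeff X \<tau> f \<in> pgf X}"


section \<open>ReDiP programs and their transformers\<close>

datatype (vars: 'i) redip =
    Assign 'i nat
  | Decr 'i
  | IncrIid 'i "nat spmf" 'i
  | IfLess 'i nat "'i redip" "'i redip"
  | Seq "'i redip" "'i redip"
  | WhileLess 'i nat "'i redip"

text \<open>
  \<open>IncrIid x D y\<close> is \<open>x += iid(D, y)\<close>; the masses of \<open>D\<close> are the coefficients of a univariate PGF
  (nonnegative, with sum at most 1).
\<close>

text \<open>
  The least fixed point is taken among the transformers from \<open>S\<close> to \<open>S\<close>, ordered pointwise. For an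
  arbitrary \<open>\<psi>\<close> from \<open>S\<close> to \<open>S\<close>, \<open>\<Phi> \<psi>\<close> need not map into \<open>S\<close> (its mass may exceed 1), so \<open>\<Phi>\<close> is
  not an operator on a complete partial order and \<open>lfp\<close> does not apply.
\<close>

definition is_least_fixpoint ::
    "'i mfps set \<Rightarrow> (('i mfps \<Rightarrow> 'i mfps) \<Rightarrow> ('i mfps \<Rightarrow> 'i mfps)) \<Rightarrow> ('i mfps \<Rightarrow> 'i mfps) \<Rightarrow> bool"
where
  "is_least_fixpoint S \<Phi> F \<longleftrightarrow>
     F \<in> S \<rightarrow>\<^sub>E S \<and> (\<forall>f\<in>S. F f = \<Phi> F f) \<and>
     (\<forall>\<psi>\<in>S \<rightarrow>\<^sub>E S. (\<forall>f\<in>S. \<psi> f = \<Phi> \<psi> f) \<longrightarrow> (\<forall>f\<in>S. F f \<le> \<psi> f))"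

text \<open>
  \<open>is_transformer S P F\<close>: the rules define \<open>F\<close> as the transformer of \<open>P\<close> on \<open>S\<close>. It is a relation
  because the rules are partial: the series in a substitution may diverge, the argument of a
  subprogram may leave \<open>S\<close>, and a least fixed point may fail to exist. In each of these cases no \<open>F\<close>
  is related to the program. Both the PGF and the second-order transformers are instances,
  with \<open>S = pgf X\<close> and \<open>S = sop U X\<close>. Transformers are \<open>undefined\<close> outside \<open>S\<close> to make them unique.
\<close>

primrec is_transformer :: "'i mfps set \<Rightarrow> 'i redip \<Rightarrow> ('i mfps \<Rightarrow> 'i mfps) \<Rightarrow> bool" where
  "is_transformer S (Assign x n) F \<longleftrightarrow>
     F \<in> S \<rightarrow>\<^sub>E S \<and> (\<forall>g\<in>S. substitutable g x 1 \<and> F g = subst g x 1 * Var x ^ n)"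
| "is_transformer S (Decr x) F \<longleftrightarrow>
     F \<in> S \<rightarrow>\<^sub>E S \<and> (\<forall>g\<in>S. F g = shift_left x (g - subst g x 0) + subst g x 0)"
| "is_transformer S (IncrIid x D y) F \<longleftrightarrow>
     F \<in> S \<rightarrow>\<^sub>E S \<and>
     (\<forall>g\<in>S. let h = Var y * fps_at_var (Abs_fps (spmf D)) x
             in substitutable g y h \<and> F g = subst g y h)"
| "is_transformer S (IfLess x n P Q) F \<longleftrightarrow>
     F \<in> S \<rightarrow>\<^sub>E S \<and>
     (\<exists>A B. is_transformer S P A \<and> is_transformer S Q B \<and>
        (\<forall>g\<in>S. restrict_less x n g \<in> S \<and> g - restrict_less x n g \<in> S \<and>
           F g = A (restrict_less x n g) + B (g - restrict_less x n g)))"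
| "is_transformer S (Seq P Q) F \<longleftrightarrow>
     F \<in> S \<rightarrow>\<^sub>E S \<and>
     (\<exists>A B. is_transformer S P A \<and> is_transformer S Q B \<and> (\<forall>g\<in>S. F g = B (A g)))"
| "is_transformer S (WhileLess x n P) F \<longleftrightarrow>
     (\<exists>A. is_transformer S P A \<and> (\<forall>f\<in>S. restrict_less x n f \<in> S) \<and>
        is_least_fixpoint S
          (\<lambda>\<psi> f. (f - restrict_less x n f) + \<psi> (A (restrict_less x n f))) F)"

definition transformer :: "'i mfps set \<Rightarrow> 'i redip \<Rightarrow> 'i mfps \<Rightarrow> 'i mfps" where
  "transformer S P = (THE F. is_transformer S P F)"


section \<open>Basic facts about the encoding\<close>

lemma mcoeff_times_monomial:
  "mcoeff (f * monomial \<tau> c) \<sigma> =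
     (if \<exists>\<rho>. \<sigma> = \<rho> + \<tau> then mcoeff f (\<sigma> - \<tau>) * c else 0)"
proof -
  have "mcoeff (f * monomial \<tau> c) \<sigma> =
      (\<Sum>p | fst p + snd p = \<sigma>. if p = (\<sigma> - \<tau>, \<tau>) then mcoeff f (\<sigma> - \<tau>) * c else 0)"
    unfolding times_mfps_def mcoeff_Abs
    by (rule sum.cong) (auto simp: monomial_def case_prod_unfold)
  also have "\<dots> = (if \<sigma> - \<tau> + \<tau> = \<sigma> then mcoeff f (\<sigma> - \<tau>) * c else 0)"
    by (simp add: sum.delta)
  also have "\<sigma> - \<tau> + \<tau> = \<sigma> \<longleftrightarrow> (\<exists>\<rho>. \<sigma> = \<rho> + \<tau>)"
    by (metis add_diff_cancel_right')
  finally show ?thesis .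
qed

lemma mcoeff_const_times: "mcoeff (const c * f) \<sigma> = c * mcoeff f \<sigma>"
  using mcoeff_times_monomial [of f 0 c \<sigma>] by (simp add: mult.commute)

lemma monomial_times_monomial: "monomial \<alpha> a * monomial \<beta> b = monomial (\<alpha> + \<beta>) (a * b)"
proof (rule mfps_eqI)
  fix \<sigma>
  show "mcoeff (monomial \<alpha> a * monomial \<beta> b) \<sigma> = mcoeff (monomial (\<alpha> + \<beta>) (a * b)) \<sigma>"
    unfolding mcoeff_times_monomial by (auto simp: monomial_def)
qed

lemma Var_power: "Var x ^ n = monomial (Poly_Mapping.single x n) 1"
proof (induction n)
  case 0
  show ?case
    by (rule mfps_eqI) (simp add: monomial_def)
next
  case (Suc n)
  then show ?case
    by (simp add: monomial_times_monomial single_add [symmetric])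
qed

lemma mcoeff_fps_at_var:
  "mcoeff (fps_at_var p x) \<sigma> = (if keys \<sigma> \<subseteq> {x} then fps_nth p (lookup \<sigma> x) else 0)"
proof -
  have single_iff: "\<sigma> = Poly_Mapping.single x n \<longleftrightarrow> keys \<sigma> \<subseteq> {x} \<and> n = lookup \<sigma> x" for n
  proof
    assume "keys \<sigma> \<subseteq> {x} \<and> n = lookup \<sigma> x"
    then show "\<sigma> = Poly_Mapping.single x n"
      by (intro poly_mapping_eqI) (auto simp: lookup_single when_def in_keys_iff)
  qed (auto split: if_splits)
  have "mcoeff (fps_at_var p x) \<sigma> =
      (\<Sum>\<^sub>\<infinity>n\<in>UNIV. if keys \<sigma> \<subseteq> {x} \<and> n = lookup \<sigma> x then fps_nth p n else 0)"
    unfolding fps_at_var_def formal_sum_def Var_power mcoeff_Abs mcoeff_const_times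
    by (auto simp: monomial_def single_iff intro!: infsum_cong)
  also have "\<dots> = (\<Sum>\<^sub>\<infinity>n\<in>{lookup \<sigma> x}. if keys \<sigma> \<subseteq> {x} then fps_nth p n else 0)"
    by (rule infsum_cong_neutral) auto
  finally show ?thesis
    by simp
qed

lemma mcoeff_partial_deriv_funpow:
  "mcoeff ((partial_deriv x ^^ i) g) \<sigma> =
     fact (lookup \<sigma> x + i) / fact (lookup \<sigma> x) * mcoeff g (\<sigma> + Poly_Mapping.single x i)"
proof (induction i arbitrary: \<sigma>)
  case (Suc i)
  have "\<sigma> + Poly_Mapping.single x 1 + Poly_Mapping.single x i = \<sigma> + Poly_Mapping.single x (Suc i)"
    by (simp add: add.assoc single_add [symmetric])
  then have "mcoeff ((partial_deriv x ^^ Suc i) g) \<sigma> =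
      real (lookup \<sigma> x + 1) * (fact (lookup \<sigma> x + 1 + i) / fact (lookup \<sigma> x + 1) *
        mcoeff g (\<sigma> + Poly_Mapping.single x (Suc i)))"
    using Suc [of "\<sigma> + Poly_Mapping.single x 1"]
    by (simp only: funpow.simps comp_apply partial_deriv_def [of x "(partial_deriv x ^^ i) g"]
        mcoeff_Abs lookup_add lookup_single_eq)
  also have "\<dots> = fact (lookup \<sigma> x + Suc i) / fact (lookup \<sigma> x) *
      mcoeff g (\<sigma> + Poly_Mapping.single x (Suc i))"
    by (simp add: divide_simps)
  finally show ?case .
qed simp

lemma mcoeff_restrict_less:
  "mcoeff (restrict_less x n g) \<sigma> = (if lookup \<sigma> x < n then mcoeff g \<sigma> else 0)"
proof -
  have *: "mcoeff (const (1 / fact i) * subst ((partial_deriv x ^^ i) g) x 0 * Var x ^ i) \<sigma> =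
      (if i = lookup \<sigma> x then mcoeff g \<sigma> else 0)" for i
  proof (cases "\<exists>\<rho>. \<sigma> = \<rho> + Poly_Mapping.single x i")
    case True
    then obtain \<rho> where "\<sigma> = \<rho> + Poly_Mapping.single x i" ..
    then show ?thesis
      unfolding Var_power mcoeff_times_monomial mcoeff_const_times subst_0 slice_def mcoeff_Abs
        mcoeff_partial_deriv_funpow
      by (auto simp: lookup_add)
  next
    case False
    have "i \<noteq> lookup \<sigma> x"
    proof
      assume "i = lookup \<sigma> x"
      then have "\<sigma> = (\<sigma> - Poly_Mapping.single x i) + Poly_Mapping.single x i"
        by (intro poly_mapping_eqI) (auto simp: lookup_add lookup_minus lookup_single when_def)
      with False show False
        by blast
    qed
    with False show ?thesis
      unfolding Var_power mcoeff_times_monomial by simp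
  qed
  show ?thesis
    unfolding restrict_less_def mcoeff_sum * by simp
qed

lemma meta_expansion:
  assumes "f \<in> mfps_over (U \<union> X)" "X \<inter> U = {}"
  shows "formally_summable (\<lambda>\<tau>. meta_coeff X \<tau> f * monomial \<tau> 1) {\<tau>. keys \<tau> \<subseteq> U}" (is ?A)
    and "f = formal_sum (\<lambda>\<tau>. meta_coeff X \<tau> f * monomial \<tau> 1) {\<tau>. keys \<tau> \<subseteq> U}" (is ?B)
proof -
  have "((\<lambda>\<tau>. mcoeff (meta_coeff X \<tau> f * monomial \<tau> 1) \<sigma>) has_sum mcoeff f \<sigma>) {\<tau>. keys \<tau> \<subseteq> U}" for \<sigma>
  proof -
    define \<tau>\<^sub>0 where "\<tau>\<^sub>0 = Poly_Mapping.mapp (\<lambda>i n. n when i \<in> U) \<sigma>"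
    have lookup_\<tau>\<^sub>0: "lookup \<tau>\<^sub>0 i = (if i \<in> U then lookup \<sigma> i else 0)" for i
      by (auto simp: \<tau>\<^sub>0_def lookup_mapp when_def in_keys_iff)
    have \<tau>\<^sub>0: "keys \<tau>\<^sub>0 \<subseteq> U"
      by (auto simp: in_keys_iff lookup_\<tau>\<^sub>0 split: if_splits)
    have split: "\<sigma> = (\<sigma> - \<tau>\<^sub>0) + \<tau>\<^sub>0"
      by (intro poly_mapping_eqI) (auto simp: lookup_add lookup_minus lookup_\<tau>\<^sub>0)
    have zero: "mcoeff (meta_coeff X \<tau> f * monomial \<tau> 1) \<sigma> = 0" if "keys \<tau> \<subseteq> U" "\<tau> \<noteq> \<tau>\<^sub>0" for \<tau>
    proof (rule ccontr)
      assume "\<not> ?thesis"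
      then obtain \<rho> where \<rho>: "\<sigma> = \<rho> + \<tau>" "keys \<rho> \<subseteq> X"
        by (auto simp: mcoeff_times_monomial meta_coeff_def split: if_splits)
      have "\<tau> = \<tau>\<^sub>0"
      proof (rule poly_mapping_eqI)
        fix i
        show "lookup \<tau> i = lookup \<tau>\<^sub>0 i"
          using \<rho> that(1) assms(2) unfolding lookup_\<tau>\<^sub>0
          by (auto simp: lookup_add) (metis disjoint_iff in_keys_iff subsetD)+
      qed
      with that show False
        by simp
    qed
    have main: "mcoeff (meta_coeff X \<tau>\<^sub>0 f * monomial \<tau>\<^sub>0 1) \<sigma> = mcoeff f \<sigma>"
    proof (cases "keys (\<sigma> - \<tau>\<^sub>0) \<subseteq> X")
      case True
      have "\<exists>\<rho>. \<sigma> = \<rho> + \<tau>\<^sub>0" and "\<tau>\<^sub>0 + (\<sigma> - \<tau>\<^sub>0) = \<sigma>"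
        by (metis split add.commute)+
      with True show ?thesis
        by (simp add: mcoeff_times_monomial meta_coeff_def)
    next
      case False
      then obtain i where "i \<notin> X" "lookup \<sigma> i \<noteq> lookup \<tau>\<^sub>0 i"
        by (auto simp: in_keys_iff lookup_minus) (metis order.refl)
      then have "\<not> keys \<sigma> \<subseteq> U \<union> X"
        by (auto simp: lookup_\<tau>\<^sub>0 in_keys_iff subset_iff split: if_splits)
      with assms(1) have "mcoeff f \<sigma> = 0"
        by (auto simp: mfps_over_def)
      with False show ?thesis
        by (simp add: mcoeff_times_monomial meta_coeff_def)
    qed
    have "((\<lambda>\<tau>. mcoeff (meta_coeff X \<tau> f * monomial \<tau> 1) \<sigma>) has_sum mcoeff f \<sigma>) {\<tau>\<^sub>0}"
      by (rule has_sum_finiteI) (simp_all add: main)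
    then show ?thesis
      by (rule has_sum_cong_neutral [THEN iffD1, rotated -1]) (use \<tau>\<^sub>0 zero in auto)
  qed
  note sums = this
  from sums show ?A
    unfolding formally_summable_def summable_on_def by blast
  from sums show ?B
    by (intro mfps_eqI) (simp add: formal_sum_def infsumI [OF sums])
qed

lemma pgf_eq_sop: "pgf X = sop {} X"
proof -
  have "meta_coeff X 0 f = f" if "f \<in> mfps_over X" for f
    using that by (intro mfps_eqI) (auto simp: meta_coeff_def mfps_over_def)
  then show ?thesis
    by (auto simp: sop_def pgf_def)
qed

end

theory Submission
  imports Defs
begin

text \<open>
  Every rule only touches program indeterminates, so it commutes with extracting the coefficient of
  a metamonomial; hence a transformer preserves SOP as soon as it maps PGF to PGF. For the latter
  one shows by induction on the program that the total mass does not increase. A loop is the sum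
  over \<open>j\<close> of the part of the series that leaves the loop after exactly \<open>j\<close> iterations, and the
  masses of these parts telescope.
\<close>

section \<open>Exponents and metacoefficients\<close>

text \<open>An SOP may have infinite total mass, because only its separate metacoefficients are
  bounded by 1. Mass estimates are therefore available for PGF alone, and nonnegativity, convergence
  and closure of SOP all have to be pulled back to metacoefficients. This requires that extracting a
  metacoefficient commutes with a rule before any convergence is known; the convention that a
  divergent \<open>infsum\<close> is 0 makes that possible. Since PGF are the case
  \<open>U = {}\<close> of SOP, one construction for arbitrary \<open>U\<close> yields both
  transformers. In the expansion, no infinite sum is moved through the program: it is the output
  that is expanded, and its metacoefficients are the outputs on the metacoefficients of the input.
  The operator of a loop may lead out of the set of SOP, so its least fixed point is exhibited
  explicitly and shown to be least directly. As \<open>transformer\<close> is a definite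
  description, uniqueness has to accompany existence.\<close>

lemma keys_add_nat: "keys (\<alpha> + \<beta> :: 'i \<Rightarrow>\<^sub>0 nat) = keys \<alpha> \<union> keys \<beta>"
  by (auto simp: in_keys_iff lookup_add)

lemma split_exponent:
  fixes \<sigma> :: "'i \<Rightarrow>\<^sub>0 nat"
  assumes "keys \<sigma> \<subseteq> U \<union> X"
  obtains \<tau> \<rho> where "\<sigma> = \<tau> + \<rho>" "keys \<tau> \<subseteq> U" "keys \<rho> \<subseteq> X"
proof
  define \<tau> where "\<tau> = Poly_Mapping.mapp (\<lambda>i n. n when i \<in> U) \<sigma>"
  have lookup_\<tau>: "lookup \<tau> i = (if i \<in> U then lookup \<sigma> i else 0)" for i
    by (auto simp: \<tau>_def lookup_mapp when_def in_keys_iff)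
  show "\<sigma> = \<tau> + (\<sigma> - \<tau>)"
    by (intro poly_mapping_eqI) (auto simp: lookup_add lookup_minus lookup_\<tau>)
  show "keys \<tau> \<subseteq> U"
    by (auto simp: in_keys_iff lookup_\<tau> split: if_splits)
  show "keys (\<sigma> - \<tau>) \<subseteq> X"
    using assms by (auto simp: in_keys_iff lookup_minus lookup_\<tau> subset_iff split: if_splits)
qed

lemma nonneg_mfps_iff: "0 \<le> f \<longleftrightarrow> (\<forall>\<sigma>. 0 \<le> mcoeff f \<sigma>)"
  by (simp add: less_eq_mfps_def)

lemma mcoeff_times: "mcoeff (f * g) \<sigma> = (\<Sum>(\<alpha>, \<beta>) | \<alpha> + \<beta> = \<sigma>. mcoeff f \<alpha> * mcoeff g \<beta>)"
  by (simp add: times_mfps_def)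

section \<open>Closure of the series over a set of indeterminates\<close>

lemma mfps_overD: "f \<in> mfps_over Z \<Longrightarrow> \<not> keys \<sigma> \<subseteq> Z \<Longrightarrow> mcoeff f \<sigma> = 0"
  by (auto simp: mfps_over_def)

lemma mfps_overI: "(\<And>\<sigma>. \<not> keys \<sigma> \<subseteq> Z \<Longrightarrow> mcoeff f \<sigma> = 0) \<Longrightarrow> f \<in> mfps_over Z"
  by (auto simp: mfps_over_def)

lemma mfps_over_mono: "f \<in> mfps_over Y \<Longrightarrow> Y \<subseteq> Z \<Longrightarrow> f \<in> mfps_over Z"
  by (auto simp: mfps_over_def)

lemma mfps_over_closed:
  fixes f g :: "'a mfps"
  assumes "f \<in> mfps_over Z" "g \<in> mfps_over Z"
  shows "f + g \<in> mfps_over Z" "f - g \<in> mfps_over Z" "f * g \<in> mfps_over Z"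
proof -
  show "f + g \<in> mfps_over Z" "f - g \<in> mfps_over Z"
    using assms by (auto simp: mfps_over_def) (metis add_0 subsetD diff_0_right)+
  show "f * g \<in> mfps_over Z"
  proof (rule mfps_overI)
    fix \<sigma> :: "'a \<Rightarrow>\<^sub>0 nat"
    assume "\<not> keys \<sigma> \<subseteq> Z"
    then have "mcoeff f \<alpha> * mcoeff g \<beta> = 0" if "\<alpha> + \<beta> = \<sigma>" for \<alpha> \<beta> :: "'a \<Rightarrow>\<^sub>0 nat"
      using that assms by (fastforce simp: keys_add_nat mfps_over_def)
    then show "mcoeff (f * g) \<sigma> = 0"
      unfolding mcoeff_times by (intro sum.neutral) auto
  qed
qed

lemma mfps_over_one: "1 \<in> mfps_over Z"
  by (auto simp: mfps_over_def)

lemma mfps_over_power: "f \<in> mfps_over Z \<Longrightarrow> f ^ n \<in> mfps_over Z"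
  by (induction n) (auto intro: mfps_over_one mfps_over_closed)

lemma mfps_over_formal_sum: "(\<And>a. a \<in> A \<Longrightarrow> F a \<in> mfps_over Z) \<Longrightarrow> formal_sum F A \<in> mfps_over Z"
  by (rule mfps_overI) (simp add: formal_sum_def, intro infsum_0 mfps_overD)

lemma mfps_over_slice: "f \<in> mfps_over Z \<Longrightarrow> slice x i f \<in> mfps_over Z"
  by (rule mfps_overI) (auto simp: slice_def keys_add_nat intro!: mfps_overD)

lemma mfps_over_shift_left: "f \<in> mfps_over Z \<Longrightarrow> shift_left x f \<in> mfps_over Z"
  by (rule mfps_overI) (auto simp: shift_left_def keys_add_nat intro!: mfps_overD)

lemma mfps_over_restrict_less: "f \<in> mfps_over Z \<Longrightarrow> restrict_less x n f \<in> mfps_over Z"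
  by (rule mfps_overI) (auto simp: mcoeff_restrict_less intro!: mfps_overD)

section \<open>Metacoefficients of the basic operations\<close>

lemma meta_coeff_simps:
  "meta_coeff X \<tau> (f + g) = meta_coeff X \<tau> f + meta_coeff X \<tau> g"
  "meta_coeff X \<tau> (f - g) = meta_coeff X \<tau> f - meta_coeff X \<tau> g"
  by (auto intro!: mfps_eqI simp: meta_coeff_def)

text \<open>Both sides read off the same \<open>infsum\<close> at each exponent, so divergence does
  no harm: the default value 0 then appears on both sides. Every rule defined by an infinite sum
  inherits its commutation from here.\<close>

lemma meta_coeff_formal_sum:
  "meta_coeff X \<tau> (formal_sum F A) = formal_sum (\<lambda>a. meta_coeff X \<tau> (F a)) A"
  by (auto intro!: mfps_eqI simp: meta_coeff_def formal_sum_def)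

text \<open>The exponent \<tau> does not involve \<open>x\<close>, so the test inside
  \<open>slice\<close> whether \<open>x\<close> occurs has the same outcome before and after \<tau>
  is added.\<close>

lemma meta_coeff_slice:
  assumes "x \<in> X" "keys \<tau> \<inter> X = {}"
  shows "meta_coeff X \<tau> (slice x i f) = slice x i (meta_coeff X \<tau> f)"
proof -
  have "lookup \<tau> x = 0"
    using assms by (auto simp: in_keys_iff)
  then show ?thesis
    using assms by (intro mfps_eqI) (auto simp: meta_coeff_def slice_def lookup_add keys_add_nat add.assoc)
qed

lemma meta_coeff_shift_left:
  "x \<in> X \<Longrightarrow> meta_coeff X \<tau> (shift_left x f) = shift_left x (meta_coeff X \<tau> f)"
  by (intro mfps_eqI) (auto simp: meta_coeff_def shift_left_def keys_add_nat add.assoc)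

lemma meta_coeff_restrict_less:
  assumes "x \<in> X" "keys \<tau> \<inter> X = {}"
  shows "meta_coeff X \<tau> (restrict_less x n f) = restrict_less x n (meta_coeff X \<tau> f)"
proof -
  have "lookup \<tau> x = 0"
    using assms by (auto simp: in_keys_iff)
  then show ?thesis
    by (intro mfps_eqI) (auto simp: meta_coeff_def mcoeff_restrict_less lookup_add)
qed

text \<open>The factor \<open>h\<close> contains no metaindeterminate, so \<tau> can only come from
  \<open>f\<close>: adding \<tau> to the left component embeds the decompositions of \<sigma> into
  those of \<tau> + \<sigma>, and all remaining decompositions contribute 0.\<close>

lemma meta_coeff_times:
  assumes "h \<in> mfps_over X" "keys \<tau> \<inter> X = {}"
  shows "meta_coeff X \<tau> (f * h) = meta_coeff X \<tau> f * h"
proof (rule mfps_eqI)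
  fix \<sigma>
  show "mcoeff (meta_coeff X \<tau> (f * h)) \<sigma> = mcoeff (meta_coeff X \<tau> f * h) \<sigma>"
  proof (cases "keys \<sigma> \<subseteq> X")
    case True
    have fin: "finite {(\<alpha>, \<beta>). \<alpha> + \<beta> = \<sigma>'}" for \<sigma>' :: "'a \<Rightarrow>\<^sub>0 nat"
      using finite_exponent_sums [of \<sigma>'] by (simp add: case_prod_unfold)
    have "(\<Sum>(\<alpha>, \<beta>) | \<alpha> + \<beta> = \<sigma>. mcoeff (meta_coeff X \<tau> f) \<alpha> * mcoeff h \<beta>) =
        (\<Sum>p\<in>(\<lambda>(\<alpha>, \<beta>). (\<tau> + \<alpha>, \<beta>)) ` {(\<alpha>, \<beta>). \<alpha> + \<beta> = \<sigma>}. mcoeff f (fst p) * mcoeff h (snd p))"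
      using True by (subst sum.reindex) (auto simp: inj_on_def meta_coeff_def keys_add_nat intro!: sum.cong)
    also have "\<dots> = (\<Sum>p\<in>{(\<alpha>, \<beta>). \<alpha> + \<beta> = \<tau> + \<sigma>}. mcoeff f (fst p) * mcoeff h (snd p))"
    proof (rule sum.mono_neutral_left [OF fin])
      show "\<forall>p\<in>{(\<alpha>, \<beta>). \<alpha> + \<beta> = \<tau> + \<sigma>} - (\<lambda>(\<alpha>, \<beta>). (\<tau> + \<alpha>, \<beta>)) ` {(\<alpha>, \<beta>). \<alpha> + \<beta> = \<sigma>}.
          mcoeff f (fst p) * mcoeff h (snd p) = 0"
      proof (safe, rule ccontr, simp, elim conjE)
        fix \<alpha> \<beta>
        assume sum: "\<alpha> + \<beta> = \<tau> + \<sigma>"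
          and nin: "(\<alpha>, \<beta>) \<notin> (\<lambda>(\<alpha>, \<beta>). (\<tau> + \<alpha>, \<beta>)) ` {(\<alpha>, \<beta>). \<alpha> + \<beta> = \<sigma>}"
          and "mcoeff h \<beta> \<noteq> 0"
        with assms(1) have "keys \<beta> \<subseteq> X"
          by (auto simp: mfps_over_def)
        \<comment> \<open>Where \<beta> vanishes, \<alpha> has to supply all of \<tau>; elsewhere
          \<tau> is 0. Hence \<alpha> dominates \<tau>, and the truncated subtraction \<alpha> -
          \<tau> loses nothing.\<close>
        then have *: "lookup \<tau> i = 0 \<or> lookup \<beta> i = 0" for i
          using assms(2) by (auto simp: in_keys_iff disjoint_iff subset_iff)
        have sum': "lookup \<alpha> i + lookup \<beta> i = lookup \<tau> i + lookup \<sigma> i" for i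
          using arg_cong [OF sum, of "\<lambda>p. lookup p i"] by (simp add: lookup_add)
        have "\<alpha> = \<tau> + (\<alpha> - \<tau>)"
        proof (rule poly_mapping_eqI)
          fix i show "lookup \<alpha> i = lookup (\<tau> + (\<alpha> - \<tau>)) i"
            using * [of i] sum' [of i] by (auto simp: lookup_add lookup_minus)
        qed
        moreover have "(\<alpha> - \<tau>) + \<beta> = \<sigma>"
        proof (rule poly_mapping_eqI)
          fix i show "lookup ((\<alpha> - \<tau>) + \<beta>) i = lookup \<sigma> i"
            using * [of i] sum' [of i] by (auto simp: lookup_add lookup_minus)
        qed
        ultimately show False
          using nin by (auto simp: image_iff)
      qed
    qed (auto simp: add.assoc)
    finally show ?thesis
      using True by (simp add: meta_coeff_def mcoeff_times case_prod_unfold)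
  next
    case False
    have "meta_coeff X \<tau> f * h \<in> mfps_over X"
      by (intro mfps_over_closed assms(1) mfps_overI) (simp add: meta_coeff_def)
    with False show ?thesis
      by (simp add: mfps_overD) (simp add: meta_coeff_def)
  qed
qed

section \<open>From metacoefficients back to all coefficients\<close>

lemma sop_nonneg:
  assumes "f \<in> sop U X"
  shows "0 \<le> f"
  unfolding nonneg_mfps_iff
proof
  fix \<sigma>
  show "0 \<le> mcoeff f \<sigma>"
  proof (cases "keys \<sigma> \<subseteq> U \<union> X")
    case True
    then obtain \<tau> \<rho> where *: "\<sigma> = \<tau> + \<rho>" "keys \<tau> \<subseteq> U" "keys \<rho> \<subseteq> X"
      by (rule split_exponent)
    with assms have "0 \<le> mcoeff (meta_coeff X \<tau> f) \<rho>"
      by (auto simp: sop_def pgf_def)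
    with * show ?thesis
      by (simp add: meta_coeff_def)
  next
    case False
    with assms show ?thesis
      using mfps_overD [of f "U \<union> X" \<sigma>] by (simp add: sop_def)
  qed
qed

text \<open>A single mass bound for a whole SOP need not exist, but summability is a condition on
  one coefficient at a time, and each coefficient lies in one metacoefficient or vanishes.\<close>

lemma formally_summable_metaI:
  assumes "\<And>a. a \<in> A \<Longrightarrow> F a \<in> mfps_over (U \<union> X)"
    and "\<And>\<tau>. keys \<tau> \<subseteq> U \<Longrightarrow> formally_summable (\<lambda>a. meta_coeff X \<tau> (F a)) A"
  shows "formally_summable F A"
  unfolding formally_summable_def
proof
  fix \<sigma>
  show "(\<lambda>a. mcoeff (F a) \<sigma>) summable_on A"
  proof (cases "keys \<sigma> \<subseteq> U \<union> X")
    case True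
    then obtain \<tau> \<rho> where *: "\<sigma> = \<tau> + \<rho>" "keys \<tau> \<subseteq> U" "keys \<rho> \<subseteq> X"
      by (rule split_exponent)
    with assms(2) have "(\<lambda>a. mcoeff (meta_coeff X \<tau> (F a)) \<rho>) summable_on A"
      by (auto simp: formally_summable_def)
    with * show ?thesis
      by (simp add: meta_coeff_def)
  next
    case False
    then have "(\<lambda>a. mcoeff (F a) \<sigma>) summable_on A \<longleftrightarrow> (\<lambda>a. 0 :: real) summable_on A"
      using mfps_overD [OF assms(1)] by (intro summable_on_cong) auto
    then show ?thesis
      by simp
  qed
qed


section \<open>Total mass\<close>

text \<open>
  Counting-measure integrals over \<open>[0, \<infinity>]\<close> exchange without summability side conditions, unlike
  the real-valued sums in the definitions.
\<close>

definition mass :: "'i mfps \<Rightarrow> ennreal" where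
  "mass f = (\<integral>\<^sup>+\<sigma>. ennreal (mcoeff f \<sigma>) \<partial>count_space UNIV)"

section \<open>Nonnegative real sums as integrals over the counting measure\<close>

lemma summable_on_if_nn_integral:
  fixes f :: "'a \<Rightarrow> real"
  assumes "\<And>x. 0 \<le> f x" "(\<integral>\<^sup>+x. ennreal (f x) \<partial>count_space A) < \<infinity>"
  shows "f summable_on A"
proof -
  have "integrable (count_space A) f"
    using assms by (intro integrableI_bounded) auto
  then have "Infinite_Set_Sum.abs_summable_on f A"
    by (simp add: Infinite_Set_Sum.abs_summable_on_def)
  then show ?thesis
    by (simp add: abs_summable_equivalent [symmetric] abs_summable_summable)
qed

lemma nn_integral_eq_infsum:
  fixes f :: "'a \<Rightarrow> real"
  assumes "\<And>x. 0 \<le> f x" "f summable_on A"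
  shows "(\<integral>\<^sup>+x. ennreal (f x) \<partial>count_space A) = ennreal (infsum f A)"
proof -
  have "Infinite_Set_Sum.abs_summable_on f A"
    using assms by (simp add: abs_summable_equivalent [symmetric])
  then show ?thesis
    using assms by (simp add: nn_integral_conv_infsetsum infsetsum_infsum)
qed

text \<open>A finite integral already forces the real sum to exist, so the existential over sums
  disappears. The conjunct \<open>0 \<le> f\<close> is essential beside the mass bound, because
  \<open>ennreal\<close> truncates negative coefficients to 0.\<close>

lemma pgf_iff: "f \<in> pgf X \<longleftrightarrow> f \<in> mfps_over X \<and> 0 \<le> f \<and> mass f \<le> 1"
proof -
  have "(\<exists>s\<le>1. (mcoeff f has_sum s) UNIV) \<longleftrightarrow> mass f \<le> 1" if nn: "\<And>\<sigma>. 0 \<le> mcoeff f \<sigma>"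
  proof
    assume "\<exists>s\<le>1. (mcoeff f has_sum s) UNIV"
    then obtain s where s: "s \<le> 1" "(mcoeff f has_sum s) UNIV"
      by blast
    then have "mass f = ennreal s"
      unfolding mass_def by (subst nn_integral_eq_infsum) (auto simp: nn summable_on_def infsumI)
    with s show "mass f \<le> 1"
      by (simp add: ennreal_le_1)
  next
    assume le: "mass f \<le> 1"
    then have "mass f < \<infinity>"
      by (rule order.strict_trans1) simp
    then have summ: "mcoeff f summable_on UNIV"
      unfolding mass_def by (intro summable_on_if_nn_integral nn)
    then have "mass f = ennreal (infsum (mcoeff f) UNIV)"
      unfolding mass_def by (intro nn_integral_eq_infsum nn)
    with le have "infsum (mcoeff f) UNIV \<le> 1"
      by (simp add: ennreal_le_1)
    with has_sum_infsum [OF summ] show "\<exists>s\<le>1. (mcoeff f has_sum s) UNIV"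
      by (intro exI conjI)
  qed
  then show ?thesis
    unfolding pgf_def nonneg_mfps_iff by auto
qed

lemma mass_pgf_finite: "f \<in> pgf X \<Longrightarrow> mass f < \<infinity>"
  unfolding pgf_iff using order.strict_trans1 [of "mass f" 1 "\<infinity>"] by simp

lemma mass_add: "0 \<le> f \<Longrightarrow> 0 \<le> g \<Longrightarrow> mass (f + g) = mass f + mass g"
  by (simp add: mass_def nonneg_mfps_iff ennreal_plus nn_integral_add)

lemma mcoeff_le_mass: "ennreal (mcoeff f \<sigma>) \<le> mass f"
proof -
  have "ennreal (mcoeff f \<sigma>) = (\<integral>\<^sup>+\<sigma>'. ennreal (mcoeff f \<sigma>') \<partial>count_space {\<sigma>})"
    by (simp add: nn_integral_count_space_finite)
  also have "\<dots> \<le> mass f"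
    unfolding mass_def
    by (subst (1) nn_integral_count_space_indicator)
       (auto intro!: nn_integral_mono simp del: nn_integral_indicator_singleton split: split_indicator)
  finally show ?thesis .
qed

text \<open>Serves to compare masses after a reindexing of exponents: injectivity ensures that no
  coefficient is counted twice.\<close>

lemma nn_integral_inj_on_le:
  fixes f :: "'b \<Rightarrow> ennreal"
  assumes "inj_on g A"
  shows "(\<integral>\<^sup>+x. f (g x) \<partial>count_space A) \<le> (\<integral>\<^sup>+y. f y \<partial>count_space UNIV)"
proof -
  have "(\<integral>\<^sup>+x. f (g x) \<partial>count_space A) = (\<integral>\<^sup>+y. f y \<partial>count_space (g ` A))"
    using assms by (intro nn_integral_bij_count_space inj_on_imp_bij_betw)
  also have "\<dots> \<le> (\<integral>\<^sup>+y. f y \<partial>count_space UNIV)"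
    by (subst nn_integral_count_space_indicator)
       (auto intro!: nn_integral_mono split: split_indicator)
  finally show ?thesis .
qed

lemma nonneg_times_mfps: "0 \<le> f \<Longrightarrow> 0 \<le> g \<Longrightarrow> 0 \<le> (f * g :: 'i mfps)"
  unfolding nonneg_mfps_iff mcoeff_times by (auto intro!: sum_nonneg)

text \<open>Tonelli: every pair of exponents contributes to exactly one coefficient of the
  product.\<close>

lemma mass_times:
  fixes f g :: "'i mfps"
  assumes "0 \<le> f" "0 \<le> g"
  shows "mass (f * g) = mass f * mass g"
proof -
  let ?t = "\<lambda>p :: ('i \<Rightarrow>\<^sub>0 nat) \<times> ('i \<Rightarrow>\<^sub>0 nat). ennreal (mcoeff f (fst p)) * ennreal (mcoeff g (snd p))"
  have nn: "0 \<le> mcoeff f \<sigma>" "0 \<le> mcoeff g \<sigma>" for \<sigma>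
    using assms by (auto simp: nonneg_mfps_iff)
  \<comment> \<open>The constraint on the pairs moves into an indicator, so that the inner domain no
    longer depends on \<sigma> and the two integrals can be exchanged.\<close>
  have "ennreal (mcoeff (f * g) \<sigma>) = (\<integral>\<^sup>+p. ?t p * indicator {fst p + snd p} \<sigma> \<partial>count_space UNIV)"
    for \<sigma>
  proof -
    have "ennreal (mcoeff (f * g) \<sigma>) = (\<Sum>p | fst p + snd p = \<sigma>. ?t p)"
      unfolding mcoeff_times case_prod_unfold
      by (subst sum_ennreal [symmetric]) (simp_all add: nn ennreal_mult)
    also have "\<dots> = (\<integral>\<^sup>+p. ?t p \<partial>count_space {p. fst p + snd p = \<sigma>})"
      by (rule nn_integral_count_space_finite [symmetric]) simp
    also have "\<dots> = (\<integral>\<^sup>+p. ?t p * indicator {fst p + snd p} \<sigma> \<partial>count_space UNIV)"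
      by (subst nn_integral_count_space_indicator)
         (auto intro!: nn_integral_cong split: split_indicator)
    finally show ?thesis .
  qed
  then have "mass (f * g) =
      (\<integral>\<^sup>+\<sigma>. \<integral>\<^sup>+p. ?t p * indicator {fst p + snd p} \<sigma> \<partial>count_space UNIV \<partial>count_space UNIV)"
    by (simp add: mass_def)
  also have "\<dots> = (\<integral>\<^sup>+p. \<integral>\<^sup>+\<sigma>. ?t p * indicator {fst p + snd p} \<sigma> \<partial>count_space UNIV \<partial>count_space UNIV)"
    using nn_integral_fst_count_space [of "\<lambda>(\<sigma>, p). ?t p * indicator {fst p + snd p} \<sigma>"]
      nn_integral_snd_count_space [of "\<lambda>(\<sigma>, p). ?t p * indicator {fst p + snd p} \<sigma>"]
    by simp
  also have "\<dots> = (\<integral>\<^sup>+p. ?t p \<partial>count_space UNIV)"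
    by (intro nn_integral_cong) (simp add: nn_integral_cmult)
  also have "\<dots> = (\<integral>\<^sup>+\<alpha>. \<integral>\<^sup>+\<beta>. ?t (\<alpha>, \<beta>) \<partial>count_space UNIV \<partial>count_space UNIV)"
    by (rule nn_integral_fst_count_space [symmetric])
  also have "\<dots> = mass f * mass g"
    by (simp add: mass_def nn_integral_cmult nn_integral_multc)
  finally show ?thesis .
qed

section \<open>Monomials, products and powers of PGF\<close>

lemma mass_monomial: "mass (monomial \<tau> c) = ennreal c"
proof -
  have "mass (monomial \<tau> c) = (\<integral>\<^sup>+\<sigma>. ennreal c * indicator {\<tau>} \<sigma> \<partial>count_space UNIV)"
    unfolding mass_def by (intro nn_integral_cong) (auto simp: monomial_def split: split_indicator)
  then show ?thesis
    by (simp add: nn_integral_cmult)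
qed

lemma one_eq_monomial: "1 = monomial 0 1"
  by (rule mfps_eqI) (simp add: monomial_def)

lemma pgf_one: "1 \<in> pgf X"
  by (auto simp: pgf_iff mfps_over_one nonneg_mfps_iff) (simp add: one_eq_monomial mass_monomial)

lemma pgf_times: "f \<in> pgf X \<Longrightarrow> g \<in> pgf X \<Longrightarrow> f * g \<in> pgf X"
  by (auto simp: pgf_iff mass_times intro!: mfps_over_closed nonneg_times_mfps mult_le_one)

lemma pgf_power: "f \<in> pgf X \<Longrightarrow> f ^ n \<in> pgf X"
  by (induction n) (auto intro: pgf_one pgf_times)

lemma pgf_Var: "x \<in> X \<Longrightarrow> Var x \<in> pgf X"
  unfolding pgf_iff mass_monomial
  by (auto simp: nonneg_mfps_iff mfps_over_def monomial_def split: if_splits)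

section \<open>Mass and convergence of formal sums and substitutions\<close>

lemma nonneg_formal_sum: "(\<And>a. 0 \<le> F a) \<Longrightarrow> 0 \<le> formal_sum F A"
  unfolding nonneg_mfps_iff formal_sum_def by (auto intro!: infsum_nonneg)

text \<open>Only an inequality, since \<open>infsum\<close> drops to 0 at a coefficient whose series
  diverges. The upper bound thus holds for every nonnegative family, convergent or not.\<close>

lemma mass_formal_sum_le:
  assumes "\<And>a. 0 \<le> F a"
  shows "mass (formal_sum F UNIV) \<le> (\<integral>\<^sup>+a. mass (F a) \<partial>count_space UNIV)"
proof -
  have nn: "0 \<le> mcoeff (F a) \<sigma>" for a \<sigma>
    using assms by (auto simp: nonneg_mfps_iff)
  have "mass (formal_sum F UNIV) \<le>
      (\<integral>\<^sup>+\<sigma>. \<integral>\<^sup>+a. ennreal (mcoeff (F a) \<sigma>) \<partial>count_space UNIV \<partial>count_space UNIV)"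
    unfolding mass_def
  proof (rule nn_integral_mono)
    fix \<sigma>
    show "ennreal (mcoeff (formal_sum F UNIV) \<sigma>) \<le> (\<integral>\<^sup>+a. ennreal (mcoeff (F a) \<sigma>) \<partial>count_space UNIV)"
    proof (cases "(\<lambda>a. mcoeff (F a) \<sigma>) summable_on UNIV")
      case True
      then show ?thesis
        by (simp add: nn_integral_eq_infsum nn formal_sum_def)
    qed (simp add: formal_sum_def infsum_not_exists)
  qed
  also have "\<dots> = (\<integral>\<^sup>+a. mass (F a) \<partial>count_space UNIV)"
    unfolding mass_def
    using nn_integral_fst_count_space [of "\<lambda>(\<sigma>, a). ennreal (mcoeff (F a) \<sigma>)"]
      nn_integral_snd_count_space [of "\<lambda>(\<sigma>, a). ennreal (mcoeff (F a) \<sigma>)"]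
    by simp
  finally show ?thesis .
qed

lemma formally_summable_if_mass:
  assumes "\<And>a. 0 \<le> F a" "(\<integral>\<^sup>+a. mass (F a) \<partial>count_space UNIV) < \<infinity>"
  shows "formally_summable F UNIV"
  unfolding formally_summable_def
proof (intro allI summable_on_if_nn_integral)
  fix \<sigma>
  show "0 \<le> mcoeff (F a) \<sigma>" for a
    using assms(1) by (auto simp: nonneg_mfps_iff)
  show "(\<integral>\<^sup>+a. ennreal (mcoeff (F a) \<sigma>) \<partial>count_space UNIV) < \<infinity>"
    by (rule le_less_trans [OF _ assms(2)]) (intro nn_integral_mono mcoeff_le_mass)
qed

lemma nonneg_slice: "0 \<le> f \<Longrightarrow> 0 \<le> slice x i f"
  by (auto simp: nonneg_mfps_iff slice_def)

text \<open>The index \<open>i\<close> and an exponent free of \<open>x\<close> can be recovered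
  from the exponent at which the slice reads \<open>f\<close>, so different slices draw on different
  coefficients of \<open>f\<close>.\<close>

lemma mass_slices_le:
  fixes f :: "'i mfps"
  shows "(\<integral>\<^sup>+i. mass (slice x i f) \<partial>count_space UNIV) \<le> mass f"
proof -
  let ?A = "{p :: nat \<times> ('i \<Rightarrow>\<^sub>0 nat). lookup (snd p) x = 0}"
  let ?g = "\<lambda>p :: nat \<times> ('i \<Rightarrow>\<^sub>0 nat). snd p + Poly_Mapping.single x (fst p)"
  have "(\<integral>\<^sup>+i. mass (slice x i f) \<partial>count_space UNIV) =
      (\<integral>\<^sup>+p. ennreal (mcoeff (slice x (fst p) f) (snd p)) \<partial>count_space UNIV)"
    unfolding mass_def
    using nn_integral_fst_count_space [of "\<lambda>(i, \<sigma>). ennreal (mcoeff (slice x i f) \<sigma>)"]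
    by (simp add: case_prod_unfold)
  also have "\<dots> = (\<integral>\<^sup>+p. ennreal (mcoeff f (?g p)) \<partial>count_space ?A)"
    by (subst nn_integral_count_space_indicator)
       (auto intro!: nn_integral_cong simp: slice_def split: split_indicator)
  also have "\<dots> \<le> mass f"
    unfolding mass_def
  proof (rule nn_integral_inj_on_le, rule inj_onI)
    fix p q assume pq: "p \<in> ?A" "q \<in> ?A" "?g p = ?g q"
    have "lookup (?g p) x = lookup (?g q) x"
      using pq(3) by simp
    with pq(1,2) have "fst p = fst q"
      by (simp add: lookup_add)
    with pq(3) show "p = q"
      by (auto simp: prod_eq_iff)
  qed
  finally show ?thesis .
qed

text \<open>Powers of a PGF have mass at most 1, so multiplying a slice by one cannot enlarge its
  mass. This bound yields both the convergence of a substitution and the mass of its result.\<close>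

lemma mass_subst_terms_le:
  assumes "0 \<le> f" "h \<in> pgf X"
  shows "(\<integral>\<^sup>+i. mass (slice x i f * h ^ i) \<partial>count_space UNIV) \<le> mass f"
proof -
  have "mass (slice x i f * h ^ i) \<le> mass (slice x i f)" for i
  proof -
    have "0 \<le> h ^ i" "mass (h ^ i) \<le> 1"
      using pgf_power [OF assms(2), of i] by (auto simp: pgf_iff)
    then show ?thesis
      using mult_left_mono [of "mass (h ^ i)" 1 "mass (slice x i f)"]
      by (simp add: mass_times nonneg_slice assms(1))
  qed
  then have "(\<integral>\<^sup>+i. mass (slice x i f * h ^ i) \<partial>count_space UNIV) \<le>
      (\<integral>\<^sup>+i. mass (slice x i f) \<partial>count_space UNIV)"
    by (intro nn_integral_mono)
  also note mass_slices_le
  finally show ?thesis .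
qed

lemma pgf_fps_at_var_spmf:
  assumes "x \<in> X"
  shows "fps_at_var (Abs_fps (spmf D)) x \<in> pgf X"
proof -
  have "mass (fps_at_var (Abs_fps (spmf D)) x) \<le>
      (\<integral>\<^sup>+n. mass (const (spmf D n) * Var x ^ n) \<partial>count_space UNIV)"
    unfolding fps_at_var_def fps_nth_Abs_fps
    by (rule mass_formal_sum_le, unfold Var_power monomial_times_monomial)
       (simp add: nonneg_mfps_iff monomial_def)
  also have "\<dots> = (\<integral>\<^sup>+n. ennreal (spmf D n) \<partial>count_space UNIV)"
    unfolding Var_power monomial_times_monomial mass_monomial by simp
  also have "\<dots> \<le> 1"
    by (simp add: weight_spmf_eq_nn_integral_spmf [symmetric] weight_spmf_le_1)
  finally show ?thesis
    using assms by (auto simp: pgf_iff nonneg_mfps_iff mcoeff_fps_at_var mfps_over_def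
        split: if_splits)
qed


section \<open>Mass-decreasing maps commuting with metacoefficients\<close>

text \<open>The invariant of the induction on programs. It mentions no \<open>U\<close>, so it
  serves PGF and SOP alike: the condition on \<tau> is disjointness from \<open>X\<close>, and the
  closure clause ranges over all \<open>Z\<close>, to be used with \<open>X\<close> and with
  \<open>U \<union> X\<close>. The mass clause compares with the mass of the input instead of with
  1, because a branch adds two results and a bound by 1 for each would only give 2.\<close>

definition meta_compatible :: "'i set \<Rightarrow> ('i mfps \<Rightarrow> 'i mfps) \<Rightarrow> bool" where
  "meta_compatible X A \<longleftrightarrow>
     (\<forall>\<tau> f. keys \<tau> \<inter> X = {} \<longrightarrow> meta_coeff X \<tau> (A f) = A (meta_coeff X \<tau> f)) \<and>
     (\<forall>Z. X \<subseteq> Z \<longrightarrow> A \<in> mfps_over Z \<rightarrow> mfps_over Z) \<and>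
     (\<forall>f\<in>pgf X. 0 \<le> A f \<and> mass (A f) \<le> mass f)"

lemma meta_compatibleD:
  assumes "meta_compatible X A"
  shows "keys \<tau> \<inter> X = {} \<Longrightarrow> meta_coeff X \<tau> (A f) = A (meta_coeff X \<tau> f)"
    and "X \<subseteq> Z \<Longrightarrow> f \<in> mfps_over Z \<Longrightarrow> A f \<in> mfps_over Z"
    and "f \<in> pgf X \<Longrightarrow> 0 \<le> A f"
    and "f \<in> pgf X \<Longrightarrow> mass (A f) \<le> mass f"
    and "f \<in> pgf X \<Longrightarrow> A f \<in> pgf X"
proof -
  show "keys \<tau> \<inter> X = {} \<Longrightarrow> meta_coeff X \<tau> (A f) = A (meta_coeff X \<tau> f)"
    and *: "X \<subseteq> Z \<Longrightarrow> f \<in> mfps_over Z \<Longrightarrow> A f \<in> mfps_over Z" for Z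
    using assms by (simp_all add: meta_compatible_def Pi_iff)
  show 0: "0 \<le> A f" and 1: "mass (A f) \<le> mass f" if "f \<in> pgf X"
    using assms that by (simp_all add: meta_compatible_def)
  show "A f \<in> pgf X" if f: "f \<in> pgf X"
    using f * [of X] 0 [OF f] order.trans [OF 1 [OF f]] by (simp add: pgf_iff)
qed

lemma meta_compatible_sop:
  assumes "meta_compatible X A" "X \<inter> U = {}" "f \<in> sop U X"
  shows "A f \<in> sop U X"
proof -
  have "meta_coeff X \<tau> (A f) \<in> pgf X" if "keys \<tau> \<subseteq> U" for \<tau>
  proof -
    have "keys \<tau> \<inter> X = {}"
      using that assms(2) by auto
    then show ?thesis
      using that assms(3) by (simp add: meta_compatibleD [OF assms(1)] sop_def)
  qed
  then show ?thesis
    using assms(3) meta_compatibleD(2) [OF assms(1), of "U \<union> X" f] by (auto simp: sop_def)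
qed

section \<open>Closure under composition and iteration; multiplication and substitution\<close>

lemma meta_compatible_id: "meta_compatible X (\<lambda>f. f)"
  by (auto simp: meta_compatible_def pgf_iff)

lemma meta_compatible_comp:
  assumes A: "meta_compatible X A" and B: "meta_compatible X B"
  shows "meta_compatible X (\<lambda>f. B (A f))"
proof -
  have "mass (B (A f)) \<le> mass f" if "f \<in> pgf X" for f
    using that meta_compatibleD(4) [OF B, of "A f"] meta_compatibleD(4,5) [OF A, of f] by auto
  then show ?thesis
    using meta_compatibleD [OF A] meta_compatibleD [OF B]
    by (auto simp: meta_compatible_def)
qed

lemma meta_compatible_funpow:
  assumes "meta_compatible X A"
  shows "meta_compatible X (A ^^ n)"
proof (induction n)
  case 0
  show ?case
    using meta_compatible_id by (simp add: id_def)
next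
  case (Suc n)
  show ?case
    using meta_compatible_comp [OF Suc assms] by (simp add: comp_def)
qed

lemma meta_compatible_times:
  assumes "h \<in> pgf X"
  shows "meta_compatible X (\<lambda>f. f * h)"
proof -
  have "h \<in> mfps_over X" "0 \<le> h" "mass h \<le> 1"
    using assms by (auto simp: pgf_iff)
  moreover have "mass f * mass h \<le> mass f" for f :: "'a mfps"
    using mult_left_mono [OF \<open>mass h \<le> 1\<close>, of "mass f"] by simp
  ultimately show ?thesis
    by (auto simp: meta_compatible_def meta_coeff_times pgf_iff mass_times
          intro: mfps_over_closed mfps_over_mono nonneg_times_mfps)
qed

lemma meta_coeff_subst_term:
  assumes "x \<in> X" "h \<in> mfps_over X" "keys \<tau> \<inter> X = {}"
  shows "meta_coeff X \<tau> (slice x i f * h ^ i) = slice x i (meta_coeff X \<tau> f) * h ^ i"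
  using assms by (simp add: meta_coeff_times meta_coeff_slice mfps_over_power)

lemma nonneg_subst_term:
  assumes "0 \<le> f" "h \<in> pgf X"
  shows "0 \<le> slice x i f * h ^ i"
  using pgf_power [OF assms(2), of i] by (simp add: nonneg_times_mfps nonneg_slice assms(1) pgf_iff)

lemma meta_compatible_subst:
  assumes "x \<in> X" "h \<in> pgf X"
  shows "meta_compatible X (\<lambda>f. subst f x h)"
  unfolding meta_compatible_def
proof (intro conjI allI impI ballI funcsetI)
  have h: "h \<in> mfps_over X"
    using assms by (simp add: pgf_iff)
  fix f
  show "meta_coeff X \<tau> (subst f x h) = subst (meta_coeff X \<tau> f) x h" if "keys \<tau> \<inter> X = {}" for \<tau>
    unfolding subst_def meta_coeff_formal_sum using that by (simp add: meta_coeff_subst_term assms h)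
  show "subst f x h \<in> mfps_over Z" if "X \<subseteq> Z" "f \<in> mfps_over Z" for Z
    unfolding subst_def
    by (intro mfps_over_formal_sum mfps_over_closed mfps_over_slice that mfps_over_power
          mfps_over_mono [OF h])
  assume "f \<in> pgf X"
  then have f: "0 \<le> f"
    by (simp add: pgf_iff)
  show "0 \<le> subst f x h"
    unfolding subst_def by (intro nonneg_formal_sum nonneg_subst_term [OF f assms(2)])
  show "mass (subst f x h) \<le> mass f"
    unfolding subst_def
    using mass_formal_sum_le [OF nonneg_subst_term [OF f assms(2)]] mass_subst_terms_le [OF f assms(2)]
    by (rule order.trans)
qed

text \<open>On a metacoefficient the terms become those of a substitution into a PGF, whose masses
  have a finite sum; convergence on the SOP follows coefficient by coefficient.\<close>

lemma substitutable_sop: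
  fixes f :: "'a mfps"
  assumes "x \<in> X" "h \<in> pgf X" "X \<inter> U = {}" "f \<in> sop U X"
  shows "substitutable f x h"
  unfolding substitutable_def
proof (rule formally_summable_metaI)
  have h: "h \<in> mfps_over X"
    using assms by (simp add: pgf_iff)
  show "slice x i f * h ^ i \<in> mfps_over (U \<union> X)" for i
    using assms(4)
    by (intro mfps_over_closed mfps_over_slice mfps_over_power mfps_over_mono [OF h])
       (auto simp: sop_def)
  fix \<tau> :: "'a \<Rightarrow>\<^sub>0 nat"
  assume \<tau>: "keys \<tau> \<subseteq> U"
  then have "keys \<tau> \<inter> X = {}"
    using assms(3) by auto
  then have terms: "meta_coeff X \<tau> (slice x i f * h ^ i) = slice x i (meta_coeff X \<tau> f) * h ^ i" for i
    using assms(1) h by (intro meta_coeff_subst_term)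
  have g: "meta_coeff X \<tau> f \<in> pgf X"
    using \<tau> assms(4) by (simp add: sop_def)
  then have nonneg: "0 \<le> meta_coeff X \<tau> f"
    by (simp add: pgf_iff)
  show "formally_summable (\<lambda>i. meta_coeff X \<tau> (slice x i f * h ^ i)) UNIV"
    unfolding terms
    using nonneg_subst_term [OF nonneg assms(2)]
      le_less_trans [OF mass_subst_terms_le [OF nonneg assms(2)] mass_pgf_finite [OF g]]
    by (rule formally_summable_if_mass)
qed

text \<open>The shifted series reads \<open>f\<close> at pairwise distinct exponents. The part of
  \<open>f\<close> without \<open>x\<close> is lost, which is harmless for an upper bound.\<close>

lemma meta_compatible_shift_left:
  assumes "x \<in> X"
  shows "meta_compatible X (shift_left x)"
proof -
  have "mass (shift_left x f) \<le> mass f" for f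
    unfolding mass_def shift_left_def mcoeff_Abs
    by (rule nn_integral_inj_on_le [where g = "\<lambda>\<sigma>. \<sigma> + Poly_Mapping.single x 1"]) (simp add: inj_on_def)
  then show ?thesis
    using assms
    by (auto simp: meta_compatible_def meta_coeff_shift_left mfps_over_shift_left pgf_iff nonneg_mfps_iff)
       (auto simp: shift_left_def)
qed

section \<open>Guards and conditional branching\<close>

lemma nonneg_restrict_less:
  assumes "0 \<le> f"
  shows "0 \<le> restrict_less x n f" "0 \<le> f - restrict_less x n f"
  using assms by (auto simp: nonneg_mfps_iff mcoeff_restrict_less)

lemma mass_restrict_less_split:
  "0 \<le> f \<Longrightarrow> mass (restrict_less x n f) + mass (f - restrict_less x n f) = mass f"
  by (subst mass_add [symmetric]) (simp_all add: nonneg_restrict_less del: add_diff_cancel)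

lemma meta_compatible_restrict_less:
  assumes "x \<in> X"
  shows "meta_compatible X (restrict_less x n)" "meta_compatible X (\<lambda>f. f - restrict_less x n f)"
proof -
  have "mass (restrict_less x n f) \<le> mass f" "mass (f - restrict_less x n f) \<le> mass f" if "0 \<le> f" for f
    using mass_restrict_less_split [OF that, of x n, symmetric] by simp_all
  with assms show "meta_compatible X (restrict_less x n)" "meta_compatible X (\<lambda>f. f - restrict_less x n f)"
    by (auto simp: meta_compatible_def meta_coeff_restrict_less meta_coeff_simps pgf_iff
        nonneg_restrict_less intro!: mfps_over_restrict_less mfps_over_closed)
qed

text \<open>The guard splits \<open>f\<close> into two nonnegative parts whose masses add up to the
  mass of \<open>f\<close>, and neither branch enlarges the mass of its own part.\<close>

lemma meta_compatible_branch:
  assumes x: "x \<in> X" and A: "meta_compatible X A" and B: "meta_compatible X B"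
  shows "meta_compatible X (\<lambda>f. A (restrict_less x n f) + B (f - restrict_less x n f))"
  unfolding meta_compatible_def
proof (intro conjI allI impI ballI funcsetI)
  note A' = meta_compatibleD [OF meta_compatible_comp [OF meta_compatible_restrict_less(1) [OF x] A]]
  note B' = meta_compatibleD [OF meta_compatible_comp [OF meta_compatible_restrict_less(2) [OF x] B]]
  fix f
  let ?L = "A (restrict_less x n f)" and ?R = "B (f - restrict_less x n f)"
  show "meta_coeff X \<tau> (?L + ?R) = A (restrict_less x n (meta_coeff X \<tau> f)) +
      B (meta_coeff X \<tau> f - restrict_less x n (meta_coeff X \<tau> f))" if "keys \<tau> \<inter> X = {}" for \<tau>
    using that by (simp add: meta_coeff_simps(1) A' B')
  show "?L + ?R \<in> mfps_over Z" if "X \<subseteq> Z" "f \<in> mfps_over Z" for Z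
    using that by (simp add: mfps_over_closed A' B')
  assume f: "f \<in> pgf X"
  then show "0 \<le> ?L + ?R"
    using A'(3) [OF f, of n] B'(3) [OF f, of n] by (auto simp: nonneg_mfps_iff)
  have "mass (?L + ?R) = mass ?L + mass ?R"
    using f by (intro mass_add A' B')
  also have "\<dots> \<le> mass (restrict_less x n f) + mass (f - restrict_less x n f)"
    using f meta_compatible_restrict_less [OF x, of n, THEN meta_compatibleD(5)]
    by (intro add_mono meta_compatibleD(4) [OF A] meta_compatibleD(4) [OF B])
  also have "\<dots> = mass f"
    using f by (simp add: mass_restrict_less_split pgf_iff)
  finally show "mass (?L + ?R) \<le> mass f" .
qed


section \<open>Loops\<close>

definition loop_exit :: "'i \<Rightarrow> nat \<Rightarrow> ('i mfps \<Rightarrow> 'i mfps) \<Rightarrow> nat \<Rightarrow> 'i mfps \<Rightarrow> 'i mfps" where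
  "loop_exit x n A j f =
     (let g = ((\<lambda>f. A (restrict_less x n f)) ^^ j) f in g - restrict_less x n g)"

text \<open>The candidate for the least fixed point is a formal sum, which makes it total on all
  series and lets it commute with metacoefficients before its convergence is established.\<close>

definition loop :: "'i \<Rightarrow> nat \<Rightarrow> ('i mfps \<Rightarrow> 'i mfps) \<Rightarrow> 'i mfps \<Rightarrow> 'i mfps" where
  "loop x n A f = formal_sum (\<lambda>j. loop_exit x n A j f) UNIV"

lemma loop_exit_0: "loop_exit x n A 0 f = f - restrict_less x n f"
  by (simp add: loop_exit_def)

text \<open>Peeling off the first pass instead of the last turns later exits into exits of the loop
  started at \<open>A (restrict_less x n f)\<close>, which is exactly the argument in the fixed
  point equation.\<close>

lemma loop_exit_Suc: "loop_exit x n A (Suc j) f = loop_exit x n A j (A (restrict_less x n f))"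
  by (simp add: loop_exit_def Let_def funpow_Suc_right del: funpow.simps)

lemma meta_compatible_loop_exit:
  assumes "x \<in> X" "meta_compatible X A"
  shows "meta_compatible X (loop_exit x n A j)"
proof -
  have *: "meta_compatible X (\<lambda>f. A (restrict_less x n f))"
    by (rule meta_compatible_comp [OF meta_compatible_restrict_less(1) [OF assms(1)] assms(2)])
  show ?thesis
    using meta_compatible_comp [OF meta_compatible_funpow [OF *, of j]
        meta_compatible_restrict_less(2) [OF assms(1), of n]]
    by (simp add: loop_exit_def [abs_def] Let_def)
qed

text \<open>The integral over the naturals is the supremum of its partial sums, so a bound for each
  \<open>k\<close> suffices. Whatever is still inside the loop after \<open>k\<close> passes is
  discarded at the base of the induction; equality therefore cannot be expected when a loop may
  diverge.\<close>

lemma mass_loop_exits_le: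
  assumes "x \<in> X" "meta_compatible X A" "f \<in> pgf X"
  shows "(\<integral>\<^sup>+j. mass (loop_exit x n A j f) \<partial>count_space UNIV) \<le> mass f"
proof -
  have "(\<Sum>j<k. mass (loop_exit x n A j f)) \<le> mass f" for k
    using assms(3)
  proof (induction k arbitrary: f)
    case (Suc k)
    have r: "restrict_less x n f \<in> pgf X"
      using Suc.prems by (rule meta_compatibleD(5) [OF meta_compatible_restrict_less(1) [OF assms(1)]])
    have "(\<Sum>j<Suc k. mass (loop_exit x n A j f)) =
        mass (f - restrict_less x n f) + (\<Sum>j<k. mass (loop_exit x n A j (A (restrict_less x n f))))"
      by (subst sum.lessThan_Suc_shift) (simp add: loop_exit_0 loop_exit_Suc)
    also have "\<dots> \<le> mass (f - restrict_less x n f) + mass (A (restrict_less x n f))"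
      using Suc.IH meta_compatibleD(5) [OF assms(2) r] by (intro add_mono order.refl)
    also have "\<dots> \<le> mass (f - restrict_less x n f) + mass (restrict_less x n f)"
      using meta_compatibleD(4) [OF assms(2) r] by (intro add_mono order.refl)
    also have "\<dots> = mass f"
      using Suc.prems by (simp add: add.commute mass_restrict_less_split pgf_iff)
    finally show ?case .
  qed simp
  then show ?thesis
    by (simp add: nn_integral_count_space_nat suminf_eq_SUP SUP_le_iff)
qed

lemma meta_compatible_loop:
  assumes "x \<in> X" "meta_compatible X A"
  shows "meta_compatible X (loop x n A)"
  unfolding meta_compatible_def
proof (intro conjI allI impI ballI funcsetI)
  note E = meta_compatibleD [OF meta_compatible_loop_exit [OF assms, of n]]
  fix f
  show "meta_coeff X \<tau> (loop x n A f) = loop x n A (meta_coeff X \<tau> f)" if "keys \<tau> \<inter> X = {}" for \<tau>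
    unfolding loop_def meta_coeff_formal_sum using that by (simp add: E)
  show "loop x n A f \<in> mfps_over Z" if "X \<subseteq> Z" "f \<in> mfps_over Z" for Z
    unfolding loop_def using that by (intro mfps_over_formal_sum E)
  assume f: "f \<in> pgf X"
  show "0 \<le> loop x n A f"
    unfolding loop_def using f by (intro nonneg_formal_sum E)
  show "mass (loop x n A f) \<le> mass f"
    unfolding loop_def using mass_formal_sum_le mass_loop_exits_le [OF assms f]
    by (rule order.trans) (use f in \<open>auto intro: E\<close>)
qed

lemma formally_summable_loop:
  fixes f :: "'a mfps"
  assumes "x \<in> X" "meta_compatible X A" "X \<inter> U = {}" "f \<in> sop U X"
  shows "formally_summable (\<lambda>j. loop_exit x n A j f) UNIV"
proof (rule formally_summable_metaI)
  note E = meta_compatibleD [OF meta_compatible_loop_exit [OF assms(1,2), of n]]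
  show "loop_exit x n A j f \<in> mfps_over (U \<union> X)" for j
    using assms(4) by (intro E) (auto simp: sop_def)
  fix \<tau> :: "'a \<Rightarrow>\<^sub>0 nat"
  assume \<tau>: "keys \<tau> \<subseteq> U"
  then have disj: "keys \<tau> \<inter> X = {}"
    using assms(3) by auto
  have g: "meta_coeff X \<tau> f \<in> pgf X"
    using \<tau> assms(4) by (auto simp: sop_def)
  show "formally_summable (\<lambda>j. meta_coeff X \<tau> (loop_exit x n A j f)) UNIV"
    unfolding E(1) [OF disj]
    using E(3) [OF g] le_less_trans [OF mass_loop_exits_le [OF assms(1,2) g] mass_pgf_finite [OF g]]
    by (rule formally_summable_if_mass)
qed

lemma is_least_fixpoint_cong:
  assumes "\<And>\<psi> f. f \<in> S \<Longrightarrow> \<Phi> \<psi> f = \<Psi> \<psi> f"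
  shows "is_least_fixpoint S \<Phi> F \<longleftrightarrow> is_least_fixpoint S \<Psi> F"
  using assms by (simp add: is_least_fixpoint_def)

text \<open>
  Unfolding the fixed point equation \<open>k\<close> times bounds any nonnegative solution from below by the
  first \<open>k\<close> exit terms; neither linearity nor monotonicity of the solution enters.
\<close>

lemma loop_is_least_fixpoint:
  assumes x: "x \<in> X" and A: "meta_compatible X A" and disj: "X \<inter> U = {}"
  shows "is_least_fixpoint (sop U X)
    (\<lambda>\<psi> f. (f - restrict_less x n f) + \<psi> (A (restrict_less x n f))) (restrict (loop x n A) (sop U X))"
proof -
  let ?S = "sop U X"
  have step: "A (restrict_less x n f) \<in> ?S" if "f \<in> ?S" for f
    using that by (intro meta_compatible_sop [OF A disj]
        meta_compatible_sop [OF meta_compatible_restrict_less(1) [OF x] disj])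
  \<comment> \<open>Unconditional sums over the naturals become ordinary series here: splitting off
    the head of such a series gives the fixed point equation, and bounds on its partial sums give
    minimality.\<close>
  have summ: "summable (\<lambda>j. mcoeff (loop_exit x n A j f) \<sigma>)" if "f \<in> ?S" for f \<sigma>
    using formally_summable_loop [OF x A disj that, of n]
    by (auto simp: formally_summable_def intro: summable_on_imp_summable)
  have loop: "mcoeff (loop x n A f) \<sigma> = suminf (\<lambda>j. mcoeff (loop_exit x n A j f) \<sigma>)" if "f \<in> ?S" for f \<sigma>
  proof -
    have "(\<lambda>j. mcoeff (loop_exit x n A j f) \<sigma>) summable_on UNIV"
      using formally_summable_loop [OF x A disj that, of n] by (auto simp: formally_summable_def)
    then show ?thesis
      unfolding loop_def formal_sum_def mcoeff_Abs
      by (intro sums_unique has_sum_imp_sums has_sum_infsum)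
  qed
  have unfold: "loop x n A f = (f - restrict_less x n f) + loop x n A (A (restrict_less x n f))"
    if "f \<in> ?S" for f
    using suminf_split_head [OF summ [OF that]]
    by (intro mfps_eqI) (simp add: loop that step loop_exit_0 loop_exit_Suc)
  have least: "loop x n A f \<le> \<psi> f"
    if \<psi>: "\<psi> \<in> ?S \<rightarrow>\<^sub>E ?S" "\<forall>f\<in>?S. \<psi> f = (f - restrict_less x n f) + \<psi> (A (restrict_less x n f))"
      and f: "f \<in> ?S" for \<psi> f
    unfolding less_eq_mfps_def
  proof
    fix \<sigma>
    have "(\<Sum>j<k. mcoeff (loop_exit x n A j f) \<sigma>) \<le> mcoeff (\<psi> f) \<sigma>" for k
      using f
    proof (induction k arbitrary: f)
      case 0
      then have "\<psi> f \<in> ?S"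
        using \<psi>(1) by auto
      then show ?case
        using sop_nonneg by (auto simp: nonneg_mfps_iff)
    next
      case (Suc k)
      have "(\<Sum>j<Suc k. mcoeff (loop_exit x n A j f) \<sigma>) =
          mcoeff (f - restrict_less x n f) \<sigma> +
            (\<Sum>j<k. mcoeff (loop_exit x n A j (A (restrict_less x n f))) \<sigma>)"
        by (subst sum.lessThan_Suc_shift) (simp add: loop_exit_0 loop_exit_Suc)
      also have "\<dots> \<le> mcoeff (f - restrict_less x n f) \<sigma> + mcoeff (\<psi> (A (restrict_less x n f))) \<sigma>"
        using Suc by (intro add_mono order.refl Suc.IH step)
      also have "\<dots> = mcoeff (\<psi> f) \<sigma>"
        using \<psi>(2) Suc.prems by (metis mcoeff_simps(3))
      finally show ?case .
    qed
    then show "mcoeff (loop x n A f) \<sigma> \<le> mcoeff (\<psi> f) \<sigma>"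
      unfolding loop [OF f] by (intro suminf_le_const summ f)
  qed
  show ?thesis
    unfolding is_least_fixpoint_def
  proof (intro conjI ballI impI)
    show "restrict (loop x n A) ?S \<in> ?S \<rightarrow>\<^sub>E ?S"
      using meta_compatible_sop [OF meta_compatible_loop [OF x A] disj] by simp
    show "restrict (loop x n A) ?S f = f - restrict_less x n f +
        restrict (loop x n A) ?S (A (restrict_less x n f))" if "f \<in> ?S" for f
      using unfold [OF that] by (simp only: restrict_apply' [OF that] restrict_apply' [OF step [OF that]])
    show "restrict (loop x n A) ?S f \<le> \<psi> f" if "\<psi> \<in> ?S \<rightarrow>\<^sub>E ?S"
      "\<forall>f\<in>?S. \<psi> f = f - restrict_less x n f + \<psi> (A (restrict_less x n f))" "f \<in> ?S" for \<psi> f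
      unfolding restrict_apply' [OF that(3)] using that by (rule least)
  qed
qed


section \<open>Denotations of programs\<close>

text \<open>
  A total function on all series, so that the PGF and the second-order transformers are
  restrictions of the same map.
\<close>

primrec denote :: "'i redip \<Rightarrow> 'i mfps \<Rightarrow> 'i mfps" where
  "denote (Assign x n) = (\<lambda>g. subst g x 1 * Var x ^ n)"
| "denote (Decr x) = (\<lambda>g. shift_left x (g - subst g x 0) + subst g x 0)"
| "denote (IncrIid x D y) = (\<lambda>g. subst g y (Var y * fps_at_var (Abs_fps (spmf D)) x))"
| "denote (IfLess x n P Q) =
     (\<lambda>g. denote P (restrict_less x n g) + denote Q (g - restrict_less x n g))"
| "denote (Seq P Q) = (\<lambda>g. denote Q (denote P g))"
| "denote (WhileLess x n P) = loop x n (denote P)"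

text \<open>Lets the decrement rule be treated as a branch on the guard
  \<open>x < 1\<close>.\<close>

lemma subst_0_eq_restrict_less: "subst f x 0 = restrict_less x 1 f"
  by (intro mfps_eqI) (auto simp: subst_0 slice_def mcoeff_restrict_less)

lemma meta_compatible_denote: "vars P \<subseteq> X \<Longrightarrow> meta_compatible X (denote P)"
proof (induction P)
  case (Assign x n)
  then have x: "x \<in> X"
    by simp
  show ?case
    using meta_compatible_comp [OF meta_compatible_subst [OF x pgf_one]
        meta_compatible_times [OF pgf_power [OF pgf_Var [OF x], of n]]]
    by simp
next
  case (Decr x)
  then have x: "x \<in> X"
    by simp
  show ?case
    \<comment> \<open>Decrement does nothing on the part with \<open>x < 1\<close> and shifts left
      on the rest; the rule lists the two summands in the opposite order.\<close>
    using meta_compatible_branch [OF x meta_compatible_id meta_compatible_shift_left [OF x], of 1]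
    by (simp add: subst_0_eq_restrict_less add.commute)
next
  case (IncrIid x D y)
  then have "x \<in> X" "y \<in> X"
    by simp_all
  then show ?case
    unfolding denote.simps
    by (intro meta_compatible_subst pgf_times pgf_Var pgf_fps_at_var_spmf)
next
  case (IfLess x n P Q)
  then show ?case
    by (auto intro!: meta_compatible_branch)
next
  case (Seq P Q)
  then show ?case
    by (auto intro: meta_compatible_comp)
next
  case (WhileLess x n P)
  then show ?case
    by (auto intro!: meta_compatible_loop)
qed

lemma denote_funcset:
  "X \<inter> U = {} \<Longrightarrow> vars P \<subseteq> X \<Longrightarrow> restrict (denote P) (sop U X) \<in> sop U X \<rightarrow>\<^sub>E sop U X"
  using meta_compatible_sop [OF meta_compatible_denote] by auto

text \<open>Existence. The partiality of the rules is discharged along the way: substitutions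
  converge by \<open>substitutable_sop\<close>, and the arguments of subprograms stay in
  \<open>sop U X\<close> because guards and \<open>denote\<close> are metacompatible. Taking
  \<open>U = {}\<close> gives the PGF transformer.\<close>

lemma is_transformer_denote:
  assumes disj: "X \<inter> U = {}"
  shows "vars P \<subseteq> X \<Longrightarrow> is_transformer (sop U X) P (restrict (denote P) (sop U X))"
proof (induction P)
  case (Assign x n)
  then have "substitutable g x 1" if "g \<in> sop U X" for g
    using that by (intro substitutable_sop [OF _ pgf_one disj]) auto
  then show ?case
    using denote_funcset [OF disj Assign.prems] unfolding is_transformer.simps
    by (auto simp: restrict_apply' simp del: restrict_PiE restrict_apply)
next
  case (Decr x)
  then show ?case
    using denote_funcset [OF disj Decr.prems] unfolding is_transformer.simps
    by (auto simp: restrict_apply' simp del: restrict_PiE restrict_apply)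
next
  case (IncrIid x D y)
  then have "substitutable g y (Var y * fps_at_var (Abs_fps (spmf D)) x)" if "g \<in> sop U X" for g
    using that
    by (intro substitutable_sop [OF _ _ disj] pgf_times pgf_Var pgf_fps_at_var_spmf) auto
  then show ?case
    using denote_funcset [OF disj IncrIid.prems] unfolding is_transformer.simps Let_def
    by (auto simp: restrict_apply' simp del: restrict_PiE restrict_apply)
next
  case (IfLess x n P Q)
  let ?A = "restrict (denote P) (sop U X)" and ?B = "restrict (denote Q) (sop U X)"
  from IfLess.prems have x: "x \<in> X"
    by simp
  have "is_transformer (sop U X) P ?A" "is_transformer (sop U X) Q ?B"
    using IfLess.IH IfLess.prems by (simp_all del: restrict_apply)
  moreover have "restrict_less x n g \<in> sop U X" "g - restrict_less x n g \<in> sop U X"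
    if "g \<in> sop U X" for g
    using that meta_compatible_restrict_less [OF x, of n, THEN meta_compatible_sop, OF disj] by auto
  ultimately show ?case
    using denote_funcset [OF disj IfLess.prems] unfolding is_transformer.simps
    by (intro conjI exI [of _ ?A] exI [of _ ?B]) (auto simp: restrict_apply' simp del: restrict_PiE restrict_apply)
next
  case (Seq P Q)
  let ?A = "restrict (denote P) (sop U X)" and ?B = "restrict (denote Q) (sop U X)"
  have "is_transformer (sop U X) P ?A" "is_transformer (sop U X) Q ?B"
    using Seq.IH Seq.prems by (simp_all del: restrict_apply)
  moreover have "denote P g \<in> sop U X" if "g \<in> sop U X" for g
    using Seq.prems by (intro meta_compatible_sop [OF meta_compatible_denote disj that]) simp
  ultimately show ?case
    using denote_funcset [OF disj Seq.prems] unfolding is_transformer.simps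
    by (intro conjI exI [of _ ?A] exI [of _ ?B]) (auto simp: restrict_apply' simp del: restrict_PiE restrict_apply)
next
  case (WhileLess x n P)
  let ?A = "restrict (denote P) (sop U X)"
  from WhileLess have x: "x \<in> X" and P: "meta_compatible X (denote P)"
    by (simp_all add: meta_compatible_denote)
  have r: "restrict_less x n f \<in> sop U X" if "f \<in> sop U X" for f
    using that by (rule meta_compatible_sop [OF meta_compatible_restrict_less(1) [OF x] disj])
  \<comment> \<open>The rule uses the restricted transformer of the body, whereas
    \<open>loop\<close> was built from the total \<open>denote P\<close>. They agree here because
    the guarded part of an SOP is again an SOP.\<close>
  have "is_least_fixpoint (sop U X)
      (\<lambda>\<psi> f. (f - restrict_less x n f) + \<psi> (?A (restrict_less x n f)))
      (restrict (loop x n (denote P)) (sop U X))"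
    by (rule is_least_fixpoint_cong [THEN iffD1, OF _ loop_is_least_fixpoint [OF x P disj]])
       (simp add: r)
  moreover have "is_transformer (sop U X) P ?A"
    using WhileLess.IH WhileLess.prems by (simp del: restrict_apply)
  ultimately show ?case
    using r unfolding is_transformer.simps denote.simps by blast
qed

section \<open>Uniqueness of transformers\<close>

lemma least_fixpoint_unique:
  assumes "is_least_fixpoint S \<Phi> F" "is_least_fixpoint S \<Phi> G"
  shows "F = G"
proof -
  from assms have F: "F \<in> S \<rightarrow>\<^sub>E S" and G: "G \<in> S \<rightarrow>\<^sub>E S"
    by (simp_all add: is_least_fixpoint_def)
  have "F f = G f" if "f \<in> S" for f
    using assms F G that unfolding is_least_fixpoint_def by (intro order.antisym) blast+
  then show ?thesis
    by (rule PiE_ext [OF F G])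
qed

text \<open>Purely a matter of the form of the rules, hence valid for every \<open>S\<close>. The
  transformers of subprograms are existentially quantified, so the induction hypotheses first
  identify the witnesses on both sides; extensionality then extends equality on \<open>S\<close> to
  all arguments.\<close>

lemma is_transformer_unique: "is_transformer S P F \<Longrightarrow> is_transformer S P G \<Longrightarrow> F = G"
proof (induction P arbitrary: F G)
  case (IfLess x n P Q)
  from IfLess.prems obtain A B A' B' where
    F: "F \<in> S \<rightarrow>\<^sub>E S" "is_transformer S P A" "is_transformer S Q B"
      "\<forall>g\<in>S. F g = A (restrict_less x n g) + B (g - restrict_less x n g)" and
    G: "G \<in> S \<rightarrow>\<^sub>E S" "is_transformer S P A'" "is_transformer S Q B'"
      "\<forall>g\<in>S. G g = A' (restrict_less x n g) + B' (g - restrict_less x n g)"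
    by auto
  have "A = A'" "B = B'"
    using F G IfLess.IH by blast+
  with F(4) G(4) show ?case
    by (intro PiE_ext [OF F(1) G(1)]) simp
next
  case (Seq P Q)
  from Seq.prems obtain A B A' B' where
    F: "F \<in> S \<rightarrow>\<^sub>E S" "is_transformer S P A" "is_transformer S Q B" "\<forall>g\<in>S. F g = B (A g)" and
    G: "G \<in> S \<rightarrow>\<^sub>E S" "is_transformer S P A'" "is_transformer S Q B'" "\<forall>g\<in>S. G g = B' (A' g)"
    by auto
  have "A = A'" "B = B'"
    using F G Seq.IH by blast+
  with F(4) G(4) show ?case
    by (intro PiE_ext [OF F(1) G(1)]) simp
next
  case (WhileLess x n P)
  from WhileLess.prems obtain A A' where
    A: "is_transformer S P A" "is_least_fixpoint S
          (\<lambda>\<psi> f. (f - restrict_less x n f) + \<psi> (A (restrict_less x n f))) F" and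
    A': "is_transformer S P A'" "is_least_fixpoint S
          (\<lambda>\<psi> f. (f - restrict_less x n f) + \<psi> (A' (restrict_less x n f))) G"
    by auto
  with WhileLess.IH have "A = A'"
    by blast
  with A A' show ?case
    by (blast intro: least_fixpoint_unique)
next
  case (Assign x n)
  then show ?case
    by (intro PiE_ext [of F S "\<lambda>_. S" G]) simp_all
next
  case (Decr x)
  then show ?case
    by (intro PiE_ext [of F S "\<lambda>_. S" G]) simp_all
next
  case (IncrIid x D y)
  then show ?case
    by (intro PiE_ext [of F S "\<lambda>_. S" G]) (simp_all add: Let_def)
qed

lemma transformer_eq_denote:
  assumes "X \<inter> U = {}" "vars P \<subseteq> X"
  shows "transformer (sop U X) P = restrict (denote P) (sop U X)"
  unfolding transformer_def
  using is_transformer_denote [OF assms] by (blast intro: is_transformer_unique)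

theorem theorem3:
  fixes P :: "'i redip" and X U :: "'i set"
  assumes "finite X" and "finite U" and "X \<inter> U = {}" and "vars P \<subseteq> X"
  shows "(\<exists>!F. is_transformer (sop U X) P F) \<and>
    transformer (sop U X) P \<in> sop U X \<rightarrow> sop U X \<and>
    (\<forall>f\<in>sop U X.
       formally_summable (\<lambda>\<tau>. transformer (pgf X) P (meta_coeff X \<tau> f) * monomial \<tau> 1) {\<tau>. keys \<tau> \<subseteq> U} \<and>
       transformer (sop U X) P f =
         formal_sum (\<lambda>\<tau>. transformer (pgf X) P (meta_coeff X \<tau> f) * monomial \<tau> 1) {\<tau>. keys \<tau> \<subseteq> U})"
proof (intro conjI ballI)
  note disj = \<open>X \<inter> U = {}\<close> and P = \<open>vars P \<subseteq> X\<close>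
  note compat = meta_compatible_denote [OF P]
  note closed = meta_compatible_sop [OF compat disj]
  show "\<exists>!F. is_transformer (sop U X) P F"
    using is_transformer_denote [OF disj P] is_transformer_unique by blast
  show "transformer (sop U X) P \<in> sop U X \<rightarrow> sop U X"
    using closed by (simp add: transformer_eq_denote [OF disj P])
  fix f assume f: "f \<in> sop U X"
  \<comment> \<open>The PGF transformer and the second-order one are restrictions of the same
    \<open>denote P\<close>, so the commutation with metacoefficients relates them directly.\<close>
  have coeff: "transformer (pgf X) P (meta_coeff X \<tau> f) = meta_coeff X \<tau> (denote P f)"
    if "keys \<tau> \<subseteq> U" for \<tau>
  proof -
    have "meta_coeff X \<tau> f \<in> pgf X"
      using f that by (simp add: sop_def)
    then have "transformer (pgf X) P (meta_coeff X \<tau> f) = denote P (meta_coeff X \<tau> f)"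
      using transformer_eq_denote [of X "{}" P] P by (simp add: pgf_eq_sop)
    also have "\<dots> = meta_coeff X \<tau> (denote P f)"
      using that disj by (intro meta_compatibleD(1) [OF compat, symmetric]) auto
    finally show ?thesis .
  qed
  \<comment> \<open>The output is the series to be expanded; \<open>coeff\<close> then identifies
    the terms of its expansion with transformed metacoefficients of \<open>f\<close>.\<close>
  have "denote P f \<in> mfps_over (U \<union> X)"
    using closed [OF f] by (simp add: sop_def)
  note exp = meta_expansion [OF this disj]
  \<comment> \<open>\<open>coeff\<close> is available only for metamonomials over \<open>U\<close>,
    so the terms are exchanged by congruence on the index set and not by rewriting the
    functions.\<close>
  have "(\<lambda>\<tau>. mcoeff (transformer (pgf X) P (meta_coeff X \<tau> f) * monomial \<tau> 1) \<sigma>) summable_on {\<tau>. keys \<tau> \<subseteq> U} \<longleftrightarrow>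
      (\<lambda>\<tau>. mcoeff (meta_coeff X \<tau> (denote P f) * monomial \<tau> 1) \<sigma>) summable_on {\<tau>. keys \<tau> \<subseteq> U}" for \<sigma>
    by (rule summable_on_cong) (simp add: coeff)
  with exp(1) show "formally_summable (\<lambda>\<tau>. transformer (pgf X) P (meta_coeff X \<tau> f) * monomial \<tau> 1) {\<tau>. keys \<tau> \<subseteq> U}"
    by (simp add: formally_summable_def)
  have expand: "formal_sum (\<lambda>\<tau>. transformer (pgf X) P (meta_coeff X \<tau> f) * monomial \<tau> 1) {\<tau>. keys \<tau> \<subseteq> U} =
      formal_sum (\<lambda>\<tau>. meta_coeff X \<tau> (denote P f) * monomial \<tau> 1) {\<tau>. keys \<tau> \<subseteq> U}"
    unfolding formal_sum_def
    by (intro arg_cong [where f = Abs_mfps] ext infsum_cong) (simp add: coeff)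
  show "transformer (sop U X) P f =
      formal_sum (\<lambda>\<tau>. transformer (pgf X) P (meta_coeff X \<tau> f) * monomial \<tau> 1) {\<tau>. keys \<tau> \<subseteq> U}"
    unfolding expand exp(2) [symmetric] using f by (simp add: transformer_eq_denote [OF disj P])
qed

end
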